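(* Let $H$ be an arbitrary finite nilpotent group and let $V \subseteq F_\infty$ be an arbitrary non-trivial word set. Then there exists a finite nilpotent group $G$ with a subnormal subgroup $\tilde H$ such that $\tilde H \cong H$ and $\tilde H \subseteq V(G)$. Moreover, if $H$ is a $\Pi$-group for a set $\Pi$ of primes, then $G$ can be chosen to be a $\Pi$-group, too.
   Context: $F_\infty$ denotes the free group of countably infinite rank; its elements are called words. A word set is a subset $V \subseteq F_\infty$; it is non-trivial if it contains a word different from the identity of $F_\infty$. For a group $G$, the verbal subgroup $V(G)$ is the subgroup of $G$ generated by all values in $G$ of the words of $V$, i.e. by all images of elements of $V$ under homomorphisms $F_\infty \to G$. A subgroup $S$ of $G$ is subnormal if there is a finite chain $S = S_0 \trianglelefteq S_1 \trianglelefteq \dots \trianglelefteq S_d = G$. A finite group is a $\Pi$-group if every prime divisor of its order lies in $\Pi$. *)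

theory Defs
  imports "HOL-Algebra.Algebra"
begin

text \<open>
  The pair \<open>(i, True)\<close> stands for the generator \<open>x\<^sub>i\<close> and \<open>(i, False)\<close> for its inverse.
  Elements of the free group are the reduced words, multiplied by concatenation
  followed by free reduction.
\<close>

type_synonym 'i letter = "'i \<times> bool"

definition inv_letter :: "'i letter \<Rightarrow> 'i letter" where
  "inv_letter x = (fst x, \<not> snd x)"

fun reduced :: "'i letter list \<Rightarrow> bool" where
  "reduced (x # y # w) \<longleftrightarrow> y \<noteq> inv_letter x \<and> reduced (y # w)"
| "reduced _ \<longleftrightarrow> True"

fun red_cons :: "'i letter \<Rightarrow> 'i letter list \<Rightarrow> 'i letter list" where
  "red_cons x [] = [x]"
| "red_cons x (y # w) = (if y = inv_letter x then w else x # y # w)"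

definition free_group :: "'i letter list monoid" where
  "free_group =
     \<lparr>carrier = {w. reduced w}, monoid.mult = (\<lambda>u v. foldr red_cons u v), one = []\<rparr>"

abbreviation F_inf :: "nat letter list monoid" where
  "F_inf \<equiv> free_group"

lemma inv_letter_inv_letter [simp]: "inv_letter (inv_letter x) = x"
  by (simp add: inv_letter_def)

lemma inv_letter_neq [simp]: "inv_letter x \<noteq> x" "x \<noteq> inv_letter x"
  by (cases x; simp add: inv_letter_def)+

lemma reduced_ConsD: "reduced (x # w) \<Longrightarrow> reduced w"
  by (cases w) auto

lemma reduced_red_cons: "reduced w \<Longrightarrow> reduced (red_cons x w)"
  by (cases w) (auto dest: reduced_ConsD)

lemma reduced_foldr_red_cons: "reduced v \<Longrightarrow> reduced (foldr red_cons u v)"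
  by (induction u) (auto intro: reduced_red_cons)

lemma red_cons_cancel:
  assumes "reduced w" shows "red_cons x (red_cons (inv_letter x) w) = w"
proof (cases w)
  case (Cons y v)
  then show ?thesis using assms by (cases v) auto
qed simp

lemma red_cons_reduced: "reduced (x # w) \<Longrightarrow> red_cons x w = x # w"
  by (cases w) auto

lemma foldr_red_cons_Nil: "reduced w \<Longrightarrow> foldr red_cons w [] = w"
proof (induction w)
  case (Cons x w)
  then show ?case using reduced_ConsD[of x w] red_cons_reduced[of x w] by simp
qed simp

lemma foldr_red_cons_red_cons:
  assumes "reduced v"
  shows "foldr red_cons (red_cons x u) v = red_cons x (foldr red_cons u v)"
  using assms red_cons_cancel[OF reduced_foldr_red_cons[OF assms]] by (cases u) auto

lemma foldr_red_cons_assoc: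
  assumes "reduced w"
  shows "foldr red_cons (foldr red_cons u v) w = foldr red_cons u (foldr red_cons v w)"
  by (induction u) (simp_all add: assms foldr_red_cons_red_cons)

lemma foldr_red_cons_inverse:
  "reduced w \<Longrightarrow> foldr red_cons (rev (map inv_letter u)) (foldr red_cons u w) = w"
proof (induction u arbitrary: w)
  case (Cons x u)
  then show ?case
    using red_cons_cancel[of "foldr red_cons u w" "inv_letter x"]
    by (simp add: reduced_foldr_red_cons)
qed simp

lemma group_free_group: "group (free_group :: 'i letter list monoid)"
proof (rule groupI)
  fix u :: "'i letter list" assume "u \<in> carrier free_group"
  then have u: "reduced u" by (simp add: free_group_def)
  let ?v = "foldr red_cons (rev (map inv_letter u)) []"
  have "?v \<otimes>\<^bsub>free_group\<^esub> u = foldr red_cons (rev (map inv_letter u)) (foldr red_cons u [])"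
    using u by (simp add: free_group_def foldr_red_cons_assoc foldr_red_cons_Nil)
  also have "\<dots> = \<one>\<^bsub>free_group\<^esub>"
    by (subst foldr_red_cons_inverse) (simp_all add: free_group_def)
  finally show "\<exists>v\<in>carrier free_group. v \<otimes>\<^bsub>free_group\<^esub> u = \<one>\<^bsub>free_group\<^esub>"
    by (intro bexI[of _ ?v]) (auto simp: free_group_def intro: reduced_foldr_red_cons)
qed (auto simp: free_group_def reduced_foldr_red_cons foldr_red_cons_assoc)

text \<open>
  Homomorphisms out of the free group correspond to arbitrary assignments of values to the
  generators: existence is \<open>word_value_hom\<close>, uniqueness \<open>hom_free_group_unique\<close>.
\<close>

definition word_value :: "('a, 'b) monoid_scheme \<Rightarrow> ('i \<Rightarrow> 'a) \<Rightarrow> 'i letter list \<Rightarrow> 'a" where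
  "word_value G f w =
     foldr (\<lambda>(i, b) a. (if b then f i else inv\<^bsub>G\<^esub> f i) \<otimes>\<^bsub>G\<^esub> a) w \<one>\<^bsub>G\<^esub>"

lemma (in group) word_value_closed:
  assumes "range f \<subseteq> carrier G" shows "word_value G f w \<in> carrier G"
proof -
  have "f i \<in> carrier G" for i using assms by auto
  then show ?thesis by (induction w) (auto simp: word_value_def)
qed

lemma (in group) word_value_Cons:
  "word_value G f ((i, b) # w) = (if b then f i else inv f i) \<otimes> word_value G f w"
  by (simp add: word_value_def)

lemma (in group) word_value_red_cons:
  assumes f: "range f \<subseteq> carrier G"
  shows "word_value G f (red_cons x w) = word_value G f (x # w)"
proof (cases w)
  case (Cons y v)
  obtain i b where x: "x = (i, b)" by (cases x)
  have fi: "f i \<in> carrier G" using f by auto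
  show ?thesis
    using word_value_closed[OF f, of v] fi
    by (auto simp: Cons x inv_letter_def word_value_Cons m_assoc[symmetric])
qed simp

lemma (in group) word_value_hom:
  assumes f: "range f \<subseteq> carrier G"
  shows "word_value G f \<in> hom free_group G"
proof -
  have "word_value G f (foldr red_cons u v) = word_value G f u \<otimes> word_value G f v" for u v
  proof (induction u)
    case Nil
    then show ?case using word_value_closed[OF f] by (simp add: word_value_def)
  next
    case (Cons x u)
    obtain i b where x: "x = (i, b)" by (cases x)
    have "f i \<in> carrier G" using f by auto
    then show ?case
      using Cons word_value_closed[OF f]
      by (simp add: word_value_red_cons[OF f] x word_value_Cons m_assoc)
  qed
  then show ?thesis
    using word_value_closed[OF f] by (auto simp: hom_def free_group_def)
qed

lemma (in group) hom_free_group_unique: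
  assumes h: "h \<in> hom free_group G" and w: "w \<in> carrier free_group"
  shows "h w = word_value G (\<lambda>i. h [(i, True)]) w"
proof -
  interpret h: group_hom free_group G h
    using h group_free_group is_group by (simp add: group_hom_def group_hom_axioms_def)
  have neg: "h [(i, False)] = inv h [(i, True)]" for i
  proof -
    have "[(i, False)] \<otimes>\<^bsub>free_group\<^esub> [(i, True)] = \<one>\<^bsub>free_group\<^esub>"
      by (simp add: free_group_def inv_letter_def)
    then have "h [(i, False)] \<otimes> h [(i, True)] = \<one>"
      by (metis h.hom_mult h.hom_one free_group_def reduced.simps(3) mem_Collect_eq
          partial_object.select_convs(1))
    then show ?thesis
      using inv_equality h.hom_closed by (simp add: free_group_def)
  qed
  show ?thesis using w
  proof (induction w)
    case Nil
    then show ?case using h.hom_one by (simp add: free_group_def word_value_def)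
  next
    case (Cons x w)
    obtain i b where x: "x = (i, b)" by (cases x)
    have red: "reduced (x # w)" "reduced w"
      using Cons.prems by (auto simp: free_group_def dest: reduced_ConsD)
    have "x # w = [x] \<otimes>\<^bsub>free_group\<^esub> w"
      using red by (simp add: free_group_def red_cons_reduced)
    then have "h (x # w) = h [x] \<otimes> h w"
      using red h.hom_mult[of "[x]" w] by (simp add: free_group_def)
    then show ?case
      using Cons.IH red neg by (simp add: x word_value_Cons free_group_def)
  qed
qed

definition verbal_subgroup ::
    "nat letter list set \<Rightarrow> ('a, 'b) monoid_scheme \<Rightarrow> 'a set" where
  "verbal_subgroup V G = generate G {h v | h v. h \<in> hom F_inf G \<and> v \<in> V}"

definition commutator_subgroup ::
    "('a, 'b) monoid_scheme \<Rightarrow> 'a set \<Rightarrow> 'a set \<Rightarrow> 'a set" where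
  "commutator_subgroup G A B =
     generate G {a \<otimes>\<^bsub>G\<^esub> b \<otimes>\<^bsub>G\<^esub> inv\<^bsub>G\<^esub> a \<otimes>\<^bsub>G\<^esub> inv\<^bsub>G\<^esub> b | a b. a \<in> A \<and> b \<in> B}"

text \<open>
  Indexing starts at 0, so that \<open>lower_central G n\<close> is the term usually written
  \<open>\<gamma>\<^sub>n\<^sub>+\<^sub>1(G)\<close>.
\<close>

fun lower_central :: "('a, 'b) monoid_scheme \<Rightarrow> nat \<Rightarrow> 'a set" where
  "lower_central G 0 = carrier G"
| "lower_central G (Suc n) = commutator_subgroup G (lower_central G n) (carrier G)"

definition nilpotent_group :: "('a, 'b) monoid_scheme \<Rightarrow> bool" where
  "nilpotent_group G \<longleftrightarrow> group G \<and> (\<exists>n. lower_central G n = {\<one>\<^bsub>G\<^esub>})"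

definition subnormal :: "'a set \<Rightarrow> ('a, 'b) monoid_scheme \<Rightarrow> bool" where
  "subnormal H G \<longleftrightarrow> subgroup H G \<and>
     (\<exists>(d::nat) S. S 0 = H \<and> S d = carrier G \<and>
        (\<forall>i<d. subgroup (S i) G \<and> S i \<lhd> G\<lparr>carrier := S (Suc i)\<rparr>))"

definition pi_group :: "nat set \<Rightarrow> ('a, 'b) monoid_scheme \<Rightarrow> bool" where
  "pi_group P G \<longleftrightarrow> group G \<and> finite (carrier G) \<and>
     (\<forall>p. Factorial_Ring.prime p \<and> p dvd order G \<longrightarrow> p \<in> P)"

end

theory Submission
  imports Defs
begin

text \<open>
  By induction on the order, \<open>H\<close> embeds into \<open>V(G)\<close> for some finite nilpotent \<open>G\<close> that involves no
  new primes. If \<open>H\<close> has two nontrivial normal subgroups with trivial intersection, \<open>H\<close> is a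
  subgroup of a direct product of two smaller quotients. Otherwise \<open>H\<close> is a \<open>p\<close>-group, because a
  finite nilpotent group contains a central element of order \<open>q\<close> for each prime divisor \<open>q\<close> of its
  order. Let then \<open>Z\<close> be the centre of \<open>H\<close>, let \<open>H/Z\<close> embed into \<open>V(K)\<close>, and let \<open>L\<close> be a
  \<open>p\<close>-group with \<open>V(L) \<noteq> 1\<close>, which exists since free groups are residually finite \<open>p\<close>-groups. The
  group \<open>G\<close> is the regular wreath product of \<open>Z\<close> by \<open>K \<times> L\<close>: commutators of its base group with an
  element of \<open>V(L)\<close> provide a copy of the \<open>K\<close>-module \<open>Z\<^sup>K\<close> inside \<open>V(G)\<close>, and \<open>H\<close> embeds into the
  product of this copy with \<open>V(K)\<close>. Subnormality is automatic in nilpotent groups.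
\<close>

section \<open>Verbal subgroups and the lower central series\<close>

lemma group_homI: "group G \<Longrightarrow> group H \<Longrightarrow> h \<in> hom G H \<Longrightarrow> group_hom G H h"
  by (simp add: group_hom_def group_hom_axioms_def)

text \<open>An induction hypothesis speaks of one carrier type only, whereas quotients and wreath
  products change it. Copying finite groups to \<open>nat\<close> keeps the type fixed.\<close>

lemma nat_group_iso:
  assumes "group G" "finite (carrier G)"
  obtains G' :: "nat monoid" and g where "group G'" "g \<in> iso G G'"
proof -
  obtain g :: "'a \<Rightarrow> nat" where g: "inj_on g (carrier G)"
    using finite_imp_inj_to_nat_seg[OF assms(2)] by blast
  have i: "g \<in> iso G (image_group g G)" using inj_imp_image_group_iso[OF g] .
  have "group (image_group g G)"
    using group.iso_imp_img_group[OF assms(1) i] by (simp add: image_group_def)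
  then show thesis using i that by blast
qed

lemma iso_order: "g \<in> iso G G' \<Longrightarrow> order G' = order G"
  by (auto simp: order_def iso_def dest: bij_betw_same_card)

lemma iso_finite_iff: "g \<in> iso G G' \<Longrightarrow> finite (carrier G') \<longleftrightarrow> finite (carrier G)"
  by (auto simp: iso_def dest: bij_betw_finite)

text \<open>Composition with \<open>f\<close> turns values of words in \<open>G\<close> into values
  of the same words in \<open>K\<close>. This is applied below to inclusions of factors and to
  conjugations.\<close>

lemma hom_verbal_subgroup:
  assumes "group G" "group K" "f \<in> hom G K" "V \<subseteq> carrier F_inf" "x \<in> verbal_subgroup V G"
  shows "f x \<in> verbal_subgroup V K"
proof -
  interpret group_hom G K f using assms by (simp add: group_homI)
  let ?S = "{h v | h v. h \<in> hom F_inf G \<and> v \<in> V}"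
  have S: "?S \<subseteq> carrier G" using assms(4) by (auto simp: hom_def)
  have "f ` ?S \<subseteq> {h v | h v. h \<in> hom F_inf K \<and> v \<in> V}"
  proof clarify
    fix h v assume "h \<in> hom F_inf G" "v \<in> V"
    then have "f \<circ> h \<in> hom F_inf K" "f (h v) = (f \<circ> h) v"
      using Group.hom_compose[OF _ assms(3)] by auto
    then show "\<exists>h' v'. f (h v) = h' v' \<and> h' \<in> hom F_inf K \<and> v' \<in> V"
      using \<open>v \<in> V\<close> by (intro exI[of _ "f \<circ> h"] exI[of _ v]) simp
  qed
  then have "f ` generate G ?S \<subseteq> verbal_subgroup V K"
    unfolding verbal_subgroup_def generate_img[OF S, symmetric] by (rule H.mono_generate)
  then show ?thesis using assms(5) unfolding verbal_subgroup_def by blast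
qed

lemma word_value_in_verbal_subgroup:
  assumes "group G" "range f \<subseteq> carrier G" "v \<in> V"
  shows "word_value G f v \<in> verbal_subgroup V G"
  unfolding verbal_subgroup_def
proof (rule generate.incl, intro CollectI exI conjI)
  show "word_value G f v = word_value G f v" ..
qed (use group.word_value_hom[OF assms(1,2)] assms(3) in auto)

lemma verbal_subgroup_subgroup:
  assumes "group G" "V \<subseteq> carrier F_inf"
  shows "subgroup (verbal_subgroup V G) G"
  unfolding verbal_subgroup_def
  by (rule group.generate_is_subgroup[OF assms(1)]) (use assms(2) in \<open>auto simp: hom_def\<close>)

lemma hom_word_value:
  assumes "group G" "group K" "h \<in> hom G K" "range f \<subseteq> carrier G"
  shows "h (word_value G f w) = word_value K (h \<circ> f) w"
proof -
  interpret group_hom G K h using assms by (simp add: group_homI)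
  show ?thesis
  proof (induction w)
    case Nil
    then show ?case by (simp add: word_value_def)
  next
    case (Cons x w)
    obtain i b where x: "x = (i, b)" by (cases x)
    have "f i \<in> carrier G" using assms(4) by auto
    then show ?case
      using Cons G.word_value_closed[OF assms(4)]
      by (simp add: x G.word_value_Cons H.word_value_Cons)
  qed
qed

section \<open>Lower central series under homomorphisms, in products and in quotients\<close>

lemma commutator_subgroup_mono:
  assumes "group G" "A \<subseteq> A'" "B \<subseteq> B'"
  shows "commutator_subgroup G A B \<subseteq> commutator_subgroup G A' B'"
  unfolding commutator_subgroup_def
  by (rule group.mono_generate[OF assms(1)]) (use assms in blast)

lemma commutator_subgroup_closed:
  assumes "group G" "A \<subseteq> carrier G" "B \<subseteq> carrier G"
  shows "commutator_subgroup G A B \<subseteq> carrier G"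
proof -
  interpret group G by fact
  show ?thesis unfolding commutator_subgroup_def
    by (rule generate_incl) (use subsetD[OF assms(2)] subsetD[OF assms(3)] in auto)
qed

lemma lower_central_closed: "group G \<Longrightarrow> lower_central G n \<subseteq> carrier G"
  by (induction n) (simp_all add: commutator_subgroup_closed)

lemma (in group_hom) img_commutator_subgroup:
  assumes "A \<subseteq> carrier G" "B \<subseteq> carrier G"
  shows "h ` commutator_subgroup G A B = commutator_subgroup H (h ` A) (h ` B)"
proof -
  let ?S = "{a \<otimes>\<^bsub>G\<^esub> b \<otimes>\<^bsub>G\<^esub> inv\<^bsub>G\<^esub> a \<otimes>\<^bsub>G\<^esub> inv\<^bsub>G\<^esub> b | a b. a \<in> A \<and> b \<in> B}"
  have S: "?S \<subseteq> carrier G" using subsetD[OF assms(1)] subsetD[OF assms(2)] by auto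
  have hom: "h (a \<otimes>\<^bsub>G\<^esub> b \<otimes>\<^bsub>G\<^esub> inv\<^bsub>G\<^esub> a \<otimes>\<^bsub>G\<^esub> inv\<^bsub>G\<^esub> b) =
      h a \<otimes>\<^bsub>H\<^esub> h b \<otimes>\<^bsub>H\<^esub> inv\<^bsub>H\<^esub> h a \<otimes>\<^bsub>H\<^esub> inv\<^bsub>H\<^esub> h b" if "a \<in> A" "b \<in> B" for a b
  proof -
    have "a \<in> carrier G" "b \<in> carrier G" using that assms by auto
    then show ?thesis by simp
  qed
  have "h ` ?S = {a \<otimes>\<^bsub>H\<^esub> b \<otimes>\<^bsub>H\<^esub> inv\<^bsub>H\<^esub> a \<otimes>\<^bsub>H\<^esub> inv\<^bsub>H\<^esub> b | a b. a \<in> h ` A \<and> b \<in> h ` B}"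
    (is "_ = ?T")
  proof
    show "h ` ?S \<subseteq> ?T"
    proof clarify
      fix a b assume "a \<in> A" "b \<in> B"
      then show "\<exists>a' b'. h (a \<otimes>\<^bsub>G\<^esub> b \<otimes>\<^bsub>G\<^esub> inv\<^bsub>G\<^esub> a \<otimes>\<^bsub>G\<^esub> inv\<^bsub>G\<^esub> b) =
          a' \<otimes>\<^bsub>H\<^esub> b' \<otimes>\<^bsub>H\<^esub> inv\<^bsub>H\<^esub> a' \<otimes>\<^bsub>H\<^esub> inv\<^bsub>H\<^esub> b' \<and> a' \<in> h ` A \<and> b' \<in> h ` B"
        using hom by (intro exI[of _ "h a"] exI[of _ "h b"]) simp
    qed
    show "?T \<subseteq> h ` ?S"
    proof
      fix y assume "y \<in> ?T"
      then obtain a b where "a \<in> A" "b \<in> B"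
        "y = h a \<otimes>\<^bsub>H\<^esub> h b \<otimes>\<^bsub>H\<^esub> inv\<^bsub>H\<^esub> h a \<otimes>\<^bsub>H\<^esub> inv\<^bsub>H\<^esub> h b" by blast
      then show "y \<in> h ` ?S"
        using hom[of a b] by (intro image_eqI[of _ _ "a \<otimes>\<^bsub>G\<^esub> b \<otimes>\<^bsub>G\<^esub> inv\<^bsub>G\<^esub> a \<otimes>\<^bsub>G\<^esub> inv\<^bsub>G\<^esub> b"]) auto
    qed
  qed
  then show ?thesis
    unfolding commutator_subgroup_def using generate_img[OF S] by simp
qed

lemma (in group_hom) img_lower_central: "h ` lower_central G n \<subseteq> lower_central H n"
proof (induction n)
  case (Suc n)
  have "h ` lower_central G (Suc n) =
      commutator_subgroup H (h ` lower_central G n) (h ` carrier G)"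
    by (simp add: img_commutator_subgroup lower_central_closed[OF G.is_group])
  also have "\<dots> \<subseteq> lower_central H (Suc n)"
    unfolding lower_central.simps
    by (rule commutator_subgroup_mono[OF H.is_group Suc]) auto
  finally show ?case .
qed auto

lemma (in group_hom) surj_img_lower_central:
  assumes "h ` carrier G = carrier H"
  shows "h ` lower_central G n = lower_central H n"
proof (induction n)
  case (Suc n)
  then show ?case
    using assms by (simp add: img_commutator_subgroup lower_central_closed[OF G.is_group])
qed (simp add: assms)

lemma lower_central_one: "group G \<Longrightarrow> \<one>\<^bsub>G\<^esub> \<in> lower_central G n"
  by (cases n) (auto simp: commutator_subgroup_def generate.one group.is_monoid monoid.one_closed)

lemma commutator_subgroup_trivial:
  assumes "group G"
  shows "commutator_subgroup G {\<one>\<^bsub>G\<^esub>} (carrier G) = {\<one>\<^bsub>G\<^esub>}"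
proof -
  interpret group G by fact
  have "commutator_subgroup G {\<one>\<^bsub>G\<^esub>} (carrier G) \<subseteq> {\<one>\<^bsub>G\<^esub>}"
    unfolding commutator_subgroup_def
    by (rule generate_subgroup_incl) (auto simp: triv_subgroup)
  then show ?thesis
    unfolding commutator_subgroup_def by (auto intro: generate.one)
qed

lemma lower_central_trivial_mono:
  assumes "group G" "lower_central G n = {\<one>\<^bsub>G\<^esub>}" "n \<le> m"
  shows "lower_central G m = {\<one>\<^bsub>G\<^esub>}"
  using assms(3) by (induction m rule: dec_induct) (simp_all add: assms commutator_subgroup_trivial)

lemma nilpotent_surj:
  assumes "nilpotent_group G" "group H" "h \<in> hom G H" "h ` carrier G = carrier H"
  shows "nilpotent_group H"
proof -
  interpret group_hom G H h using assms by (simp add: group_homI nilpotent_group_def)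
  obtain n where "lower_central G n = {\<one>\<^bsub>G\<^esub>}" using assms(1) by (auto simp: nilpotent_group_def)
  then have "lower_central H n = {\<one>\<^bsub>H\<^esub>}" using surj_img_lower_central[OF assms(4), of n] by simp
  then show ?thesis using assms(2) by (auto simp: nilpotent_group_def)
qed

lemma nilpotent_iso:
  assumes "nilpotent_group G" "group H" "g \<in> iso G H"
  shows "nilpotent_group H"
  using assms nilpotent_surj[of G H g] by (auto simp: iso_iff)

text \<open>Each projection maps the lower central series of the product into that of the factor; at
  the larger of the two indices both coordinates are trivial.\<close>

lemma nilpotent_DirProd:
  assumes "nilpotent_group G" "nilpotent_group H"
  shows "nilpotent_group (G \<times>\<times> H)"
proof -
  have G: "group G" and H: "group H" using assms by (auto simp: nilpotent_group_def)
  have GH: "group (G \<times>\<times> H)" using DirProd_group[OF G H] .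
  obtain n m where nm: "lower_central G n = {\<one>\<^bsub>G\<^esub>}" "lower_central H m = {\<one>\<^bsub>H\<^esub>}"
    using assms by (auto simp: nilpotent_group_def)
  have 1: "lower_central G (max n m) = {\<one>\<^bsub>G\<^esub>}" "lower_central H (max n m) = {\<one>\<^bsub>H\<^esub>}"
    using lower_central_trivial_mono[OF G nm(1)] lower_central_trivial_mono[OF H nm(2)] by auto
  interpret p1: group_hom "G \<times>\<times> H" G fst
    using GH G by (intro group_homI) (auto simp: hom_def)
  interpret p2: group_hom "G \<times>\<times> H" H snd
    using GH H by (intro group_homI) (auto simp: hom_def)
  have "lower_central (G \<times>\<times> H) (max n m) = {\<one>\<^bsub>G \<times>\<times> H\<^esub>}"
    using p1.img_lower_central[of "max n m"] p2.img_lower_central[of "max n m"]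
      lower_central_one[OF GH, of "max n m"] unfolding 1 by (auto simp: image_subset_iff)
  then show ?thesis using GH by (auto simp: nilpotent_group_def)
qed

text \<open>Stands in for \<open>H Mod N\<close>, whose elements are cosets: a surjection with
  kernel \<open>N\<close> onto a group on \<open>nat\<close> stays inside the type of the inductions
  on the order.\<close>

lemma quotient_nat_group:
  assumes "N \<lhd> H" "finite (carrier H)"
  obtains Q :: "nat monoid" and f where "group Q" "f \<in> hom H Q" "f ` carrier H = carrier Q"
    "kernel H Q f = N" "order Q * card N = order H" "finite (carrier Q)"
proof -
  interpret normal N H by fact
  have fin: "finite (carrier (H Mod N))"
    using assms(2) by (auto simp: FactGroup_def RCOSETS_def)
  obtain Q :: "nat monoid" and g where Q: "group Q" "g \<in> iso (H Mod N) Q"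
    using nat_group_iso[OF factorgroup_is_group fin] .
  let ?f = "g \<circ> (\<lambda>a. N #>\<^bsub>H\<^esub> a)"
  have hom: "?f \<in> hom H Q"
    using Group.hom_compose[OF r_coset_hom_Mod] Q(2) unfolding iso_def by blast
  have im: "(\<lambda>a. N #>\<^bsub>H\<^esub> a) ` carrier H = carrier (H Mod N)"
    by (auto simp: FactGroup_def RCOSETS_def)
  have surj: "?f ` carrier H = carrier Q"
    using Q(2) unfolding image_comp[symmetric] im by (simp add: iso_iff)
  have "order Q * card N = order H"
    unfolding iso_order[OF Q(2)] using lagrange[OF is_subgroup] by (simp add: order_def FactGroup_def)
  moreover have "kernel H Q ?f = N"
  proof -
    have "g N = \<one>\<^bsub>Q\<^esub>"
      using group_hom.hom_one[OF group_homI[OF factorgroup_is_group Q(1), of g]] Q(2)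
      by (simp add: iso_def FactGroup_def)
    moreover have "N \<in> carrier (H Mod N)"
      using monoid.one_closed[OF group.is_monoid[OF factorgroup_is_group]]
      by (simp add: FactGroup_def)
    moreover have "N #>\<^bsub>H\<^esub> a \<in> carrier (H Mod N)" if "a \<in> carrier H" for a using im that by blast
    moreover have "inj_on g (carrier (H Mod N))" using Q(2) by (simp add: iso_iff)
    ultimately have "g (N #>\<^bsub>H\<^esub> a) = \<one>\<^bsub>Q\<^esub> \<longleftrightarrow> N #>\<^bsub>H\<^esub> a = N" if "a \<in> carrier H" for a
      using that inj_on_eq_iff[of g "carrier (H Mod N)" "N #>\<^bsub>H\<^esub> a" N] by simp
    moreover have "N #>\<^bsub>H\<^esub> a = N \<longleftrightarrow> a \<in> N" if "a \<in> carrier H" for a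
      using that coset_join1[of N a] coset_join2[of a N] is_subgroup subset by auto
    ultimately have "?f a = \<one>\<^bsub>Q\<^esub> \<longleftrightarrow> a \<in> N" if "a \<in> carrier H" for a using that by simp
    then show ?thesis using subset by (auto simp: kernel_def)
  qed
  moreover have "finite (carrier Q)" using fin iso_finite_iff[OF Q(2)] by simp
  ultimately show thesis using that Q(1) hom surj by blast
qed

section \<open>Centres of nilpotent groups\<close>

lemma prime_power_of_unique_prime:
  fixes n p :: nat
  assumes "n > 0" "\<And>q. Factorial_Ring.prime q \<Longrightarrow> q dvd n \<Longrightarrow> q = p"
  shows "\<exists>k. n = p ^ k"
  using assms
proof (induction n rule: less_induct)
  case (less n)
  show ?case
  proof (cases "n = 1")
    case True
    then show ?thesis by (intro exI[of _ 0]) simp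
  next
    case False
    then obtain q where "Factorial_Ring.prime q" "q dvd n" using prime_factor_nat by blast
    then have p: "Factorial_Ring.prime p" "p dvd n" using less.prems(2) by blast+
    then obtain m where m: "n = p * m" by auto
    have "m < n" "m > 0" using m less.prems(1) prime_gt_1_nat[OF p(1)] by auto
    moreover have "q = p" if "Factorial_Ring.prime q" "q dvd m" for q
      using less.prems(2)[OF that(1)] that(2) m by simp
    ultimately obtain k where "m = p ^ k" using less.IH by blast
    then show ?thesis using m by (intro exI[of _ "Suc k"]) simp
  qed
qed

lemma (in group) inv_mult_cancel:
  assumes "x \<in> carrier G" "y \<in> carrier G"
  shows "inv x \<otimes> (x \<otimes> y) = y" and "x \<otimes> (inv x \<otimes> y) = y"
  using assms by (simp_all add: m_assoc[symmetric])

lemma (in group) ord_dvd_subgroup_card: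
  assumes "subgroup S G" "x \<in> S"
  shows "ord x dvd card S"
proof -
  have "x [^]\<^bsub>G\<lparr>carrier := S\<rparr>\<^esub> order (G\<lparr>carrier := S\<rparr>) = \<one>"
    using group.pow_order_eq_1[OF subgroup_imp_group[OF assms(1)], of x] assms(2) by simp
  then have "x [^] card S = \<one>"
    by (subst nat_pow_consistent[of x "card S" S]) (simp add: order_def)
  then show ?thesis using pow_eq_id[of x "card S"] subgroup.mem_carrier[OF assms] by simp
qed

text \<open>Cauchy's theorem. The existence part of Sylow's theorem with exponent one gives a
  subgroup of order \<open>q\<close>, and by Lagrange its nontrivial elements have order
  \<open>q\<close>.\<close>

lemma (in group) element_of_prime_order:
  assumes "finite (carrier G)" "Factorial_Ring.prime q" "q dvd order G"
  obtains x where "x \<in> carrier G" "ord x = q"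
proof -
  obtain m where "order G = q ^ 1 * m" using assms(3) by auto
  then obtain S where S: "subgroup S G" "card S = q"
    using sylow_thm[OF assms(2) is_group _ assms(1)] by (metis power_one_right)
  have "\<not> S \<subseteq> {\<one>}"
    using S(2) prime_gt_1_nat[OF assms(2)] card_mono[of "{\<one>}" S] by auto
  then obtain x where x: "x \<in> S" "x \<noteq> \<one>" by blast
  then have "x \<in> carrier G" using S(1) subgroup.mem_carrier by fast
  moreover have "ord x dvd q" using ord_dvd_subgroup_card[OF S(1) x(1)] S(2) by simp
  moreover have "ord x \<noteq> 1" using x(2) ord_eq_1 \<open>x \<in> carrier G\<close> by simp
  ultimately show thesis using that assms(2) by (auto simp: prime_nat_iff)
qed

section \<open>Nontrivial centres, central extensions and central elements of prime order\<close>

definition centre :: "('a, 'b) monoid_scheme \<Rightarrow> 'a set" where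
  "centre G = {z \<in> carrier G. \<forall>g\<in>carrier G. z \<otimes>\<^bsub>G\<^esub> g = g \<otimes>\<^bsub>G\<^esub> z}"

lemma centreD:
  assumes "z \<in> centre G"
  shows "z \<in> carrier G" and "g \<in> carrier G \<Longrightarrow> z \<otimes>\<^bsub>G\<^esub> g = g \<otimes>\<^bsub>G\<^esub> z"
  using assms by (auto simp: centre_def)

lemma (in group) centre_iff_commutator:
  assumes "z \<in> carrier G"
  shows "z \<in> centre G \<longleftrightarrow> (\<forall>g\<in>carrier G. z \<otimes> g \<otimes> inv z \<otimes> inv g = \<one>)"
proof -
  have "z \<otimes> g \<otimes> inv z \<otimes> inv g = \<one> \<longleftrightarrow> z \<otimes> g = g \<otimes> z" if "g \<in> carrier G" for g
  proof -
    have "z \<otimes> g \<otimes> inv z \<otimes> inv g = (z \<otimes> g) \<otimes> inv (g \<otimes> z)"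
      using assms that by (simp add: inv_mult_group m_assoc)
    then show ?thesis
      using assms that by (metis inv_closed inv_equality inv_inv m_closed r_inv)
  qed
  then show ?thesis using assms by (simp add: centre_def)
qed

lemma (in group) subgroup_centre: "subgroup (centre G) G"
proof (rule subgroupI)
  show "centre G \<noteq> {}" by (auto simp: centre_def intro: exI[of _ \<one>])
next
  fix a b assume a: "a \<in> centre G" and b: "b \<in> centre G"
  then have ab: "a \<in> carrier G" "b \<in> carrier G" by (auto simp: centre_def)
  have "a \<otimes> b \<otimes> g = g \<otimes> (a \<otimes> b)" if g: "g \<in> carrier G" for g
  proof -
    have "a \<otimes> b \<otimes> g = a \<otimes> (g \<otimes> b)" using centreD(2)[OF b g] ab g by (simp add: m_assoc)
    also have "\<dots> = g \<otimes> a \<otimes> b" using centreD(2)[OF a g] ab g by (simp add: m_assoc[symmetric])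
    finally show ?thesis using ab g by (simp add: m_assoc)
  qed
  then show "a \<otimes> b \<in> centre G" using ab by (simp add: centre_def)
next
  fix a assume a: "a \<in> centre G"
  then have ac: "a \<in> carrier G" by (simp add: centre_def)
  have "inv a \<otimes> g = g \<otimes> inv a" if g: "g \<in> carrier G" for g
  proof -
    have "a \<otimes> inv g = inv g \<otimes> a" using g by (intro centreD(2)[OF a]) simp
    then have "inv (a \<otimes> inv g) = inv (inv g \<otimes> a)" by simp
    then show ?thesis using ac g by (simp add: inv_mult_group)
  qed
  then show "inv a \<in> centre G" using ac by (simp add: centre_def)
qed (auto simp: centre_def)

lemma (in group) central_subgroup_normal:
  assumes "subgroup A G" "A \<subseteq> centre G"
  shows "A \<lhd> G"
proof -
  have "x \<otimes> h \<otimes> inv x \<in> A" if "x \<in> carrier G" "h \<in> A" for x h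
  proof -
    have "h \<in> centre G" using assms(2) that by blast
    then have "h \<in> carrier G" "x \<otimes> h = h \<otimes> x" using centreD(1)[of h G] centreD(2)[of h G x] that by auto
    then show ?thesis using that by (simp add: m_assoc)
  qed
  then show ?thesis using assms(1) by (simp add: normal_inv_iff)
qed

text \<open>Class equation. Conjugacy classes have \<open>p\<close>-power size, and a class of size
  one consists of a central element. With a trivial centre all classes but that of \<one> would have
  size divisible by \<open>p\<close>, so the order would be 1 modulo \<open>p\<close>.\<close>

lemma (in group) p_group_centre:
  assumes p: "Factorial_Ring.prime p" and G: "order G = p ^ n" "n > 0"
  shows "centre G \<noteq> {\<one>}"
proof
  assume Z: "centre G = {\<one>}"
  define \<phi> where "\<phi> = (\<lambda>g. \<lambda>h\<in>carrier G. g \<otimes> h \<otimes> inv g)"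
  interpret A: group_action G "carrier G" \<phi>
    unfolding \<phi>_def by (rule action_by_conjugation)
  let ?O = "orbits G (carrier G) \<phi>"
  have fin: "finite (carrier G)"
    using G p order_gt_0_iff_finite by (simp add: prime_gt_0_nat)
  have one: "orbit G \<phi> \<one> = {\<one>}"
    by (auto simp: orbit_def \<phi>_def intro: exI[of _ \<one>])
  have dvd: "p dvd card orb" if orb: "orb \<in> ?O - {{\<one>}}" for orb
  proof -
    obtain x where x: "x \<in> carrier G" "orb = orbit G \<phi> x" using orb by (auto simp: orbits_def)
    have "card orb dvd p ^ n"
      using A.orbit_stabilizer_theorem[OF x(1)] G(1) x(2) by (metis dvd_triv_left)
    then obtain k where k: "card orb = p ^ k" using divides_primepow_nat[OF p] by blast
    have "k \<noteq> 0"
    proof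
      assume "k = 0"
      then obtain y where y: "orb = {y}" using k by (auto simp: card_1_singleton_iff)
      have mem: "g \<otimes> x \<otimes> inv g \<in> orb" if "g \<in> carrier G" for g
        using x that by (auto simp: orbit_def \<phi>_def)
      then have "g \<otimes> x \<otimes> inv g = x" if "g \<in> carrier G" for g
        using mem[OF that] mem[of \<one>] y x(1) by simp
      then have "x \<otimes> g = g \<otimes> x" if "g \<in> carrier G" for g
        using that x(1) inv_solve_right by (metis m_closed)
      then have "x \<in> centre G" using x(1) by (simp add: centre_def)
      then show False using Z x(2) one orb by simp
    qed
    then show ?thesis using k by simp
  qed
  have finO: "finite ?O"
    using fin by (auto simp: orbits_def)
  have "order G = (\<Sum>orb\<in>?O. card orb)"
    using A.disjoint_sum[OF fin, of "\<lambda>_. 1::nat"] by (simp add: order_def)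
  also have "\<dots> = 1 + (\<Sum>orb\<in>?O - {{\<one>}}. card orb)"
  proof (subst sum.remove[OF finO, of "{\<one>}"])
    show "{\<one>} \<in> ?O" using one by (auto simp: orbits_def intro: exI[of _ \<one>])
  qed simp
  finally have "p dvd 1 + (\<Sum>orb\<in>?O - {{\<one>}}. card orb)" using G by (metis dvd_power)
  moreover have "p dvd (\<Sum>orb\<in>?O - {{\<one>}}. card orb)" using dvd by (rule dvd_sum)
  ultimately have "p dvd 1" by (metis dvd_add_left_iff)
  then show False using p by simp
qed

lemma commutator_subgroup_central:
  assumes "group G" "A \<subseteq> centre G"
  shows "commutator_subgroup G A (carrier G) = {\<one>\<^bsub>G\<^esub>}"
proof -
  interpret group G by fact
  have "a \<otimes>\<^bsub>G\<^esub> b \<otimes>\<^bsub>G\<^esub> inv\<^bsub>G\<^esub> a \<otimes>\<^bsub>G\<^esub> inv\<^bsub>G\<^esub> b = \<one>\<^bsub>G\<^esub>" if "a \<in> A" "b \<in> carrier G" for a b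
  proof -
    have "a \<in> centre G" using that(1) assms(2) by blast
    then show ?thesis using centre_iff_commutator[of a] centreD(1)[of a G] that(2) by simp
  qed
  then have "commutator_subgroup G A (carrier G) \<subseteq> {\<one>\<^bsub>G\<^esub>}"
    unfolding commutator_subgroup_def
    by (intro generate_subgroup_incl) (auto simp: triv_subgroup)
  then show ?thesis
    unfolding commutator_subgroup_def by (auto intro: generate.one)
qed

text \<open>The last nontrivial term of the lower central series is central, because its commutators
  with the group lie in the next term.\<close>

lemma nilpotent_centre:
  assumes "nilpotent_group G" "carrier G \<noteq> {\<one>\<^bsub>G\<^esub>}"
  shows "centre G \<noteq> {\<one>\<^bsub>G\<^esub>}"
proof -
  interpret group G using assms(1) by (simp add: nilpotent_group_def)
  define n where "n = (LEAST n. lower_central G n = {\<one>\<^bsub>G\<^esub>})"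
  have n: "lower_central G n = {\<one>\<^bsub>G\<^esub>}"
    using assms(1) unfolding nilpotent_group_def n_def by (metis (mono_tags, lifting) LeastI_ex)
  then obtain m where m: "n = Suc m" using assms(2) by (cases n) auto
  have ne: "lower_central G m \<noteq> {\<one>\<^bsub>G\<^esub>}"
    using not_less_Least[of m "\<lambda>n. lower_central G n = {\<one>\<^bsub>G\<^esub>}"] m n_def by simp
  have "lower_central G m \<subseteq> centre G"
  proof
    fix z assume z: "z \<in> lower_central G m"
    then have zc: "z \<in> carrier G" using lower_central_closed[OF is_group] by blast
    have "z \<otimes>\<^bsub>G\<^esub> g \<otimes>\<^bsub>G\<^esub> inv\<^bsub>G\<^esub> z \<otimes>\<^bsub>G\<^esub> inv\<^bsub>G\<^esub> g \<in> lower_central G n" if "g \<in> carrier G" for g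
      using z that by (auto simp: m commutator_subgroup_def intro!: generate.incl)
    then show "z \<in> centre G" using n zc by (simp add: centre_iff_commutator)
  qed
  moreover have "\<one>\<^bsub>G\<^esub> \<in> lower_central G m" using lower_central_one[OF is_group] .
  ultimately show ?thesis using ne by auto
qed

text \<open>When the series of \<open>Q\<close> has reached the identity, that of \<open>G\<close>
  has reached the kernel; this is central, so one more step ends the series.\<close>

lemma nilpotent_central_extension:
  assumes "group G" "nilpotent_group Q" "h \<in> hom G Q" "kernel G Q h \<subseteq> centre G"
  shows "nilpotent_group G"
proof -
  interpret group_hom G Q h using assms by (simp add: group_homI nilpotent_group_def)
  obtain n where "lower_central Q n = {\<one>\<^bsub>Q\<^esub>}" using assms(2) by (auto simp: nilpotent_group_def)
  then have "lower_central G n \<subseteq> kernel G Q h"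
    using img_lower_central[of n] lower_central_closed[OF assms(1), of n] by (auto simp: kernel_def)
  then have "lower_central G (Suc n) = {\<one>\<^bsub>G\<^esub>}"
    using assms(4) by (simp add: commutator_subgroup_central[OF assms(1)])
  then show ?thesis using assms(1) unfolding nilpotent_group_def by blast
qed

lemma card_centre_gt_1:
  assumes "group G" "finite (carrier G)" "centre G \<noteq> {\<one>\<^bsub>G\<^esub>}"
  shows "card (centre G) > 1"
proof -
  have "subgroup (centre G) G" using group.subgroup_centre[OF assms(1)] .
  then have "\<one>\<^bsub>G\<^esub> \<in> centre G" "finite (centre G)"
    using subgroup.one_closed subgroup.subset assms(2) finite_subset by fast+
  moreover have "card (centre G) \<noteq> 1"
    using assms(3) calculation(1) by (auto simp: card_1_singleton_iff)
  moreover have "card (centre G) \<noteq> 0" using calculation by auto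
  ultimately show ?thesis by linarith
qed

text \<open>The quotient by the nontrivial centre is a smaller \<open>p\<close>-group, nilpotent by
  induction, and central extensions preserve nilpotency.\<close>

lemma p_group_nilpotent:
  fixes G :: "nat monoid"
  assumes "group G" "Factorial_Ring.prime p" "order G = p ^ n"
  shows "nilpotent_group G"
  using assms
proof (induction "order G" arbitrary: G n rule: less_induct)
  case less
  interpret group G by fact
  have fin: "finite (carrier G)"
    using less.prems order_gt_0_iff_finite by (simp add: prime_gt_0_nat)
  show ?case
  proof (cases "n = 0")
    case True
    then obtain x where "carrier G = {x}" using less.prems(3) by (auto simp: order_def card_1_singleton_iff)
    then have "carrier G = {\<one>\<^bsub>G\<^esub>}" using one_closed by auto
    then have "lower_central G 0 = {\<one>\<^bsub>G\<^esub>}" by simp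
    then show ?thesis using is_group unfolding nilpotent_group_def by blast
  next
    case False
    then have "centre G \<noteq> {\<one>\<^bsub>G\<^esub>}" using p_group_centre less.prems by blast
    then have c: "card (centre G) > 1" using card_centre_gt_1[OF is_group fin] by blast
    obtain Q :: "nat monoid" and f where Q: "group Q" "f \<in> hom G Q" "f ` carrier G = carrier Q"
      "kernel G Q f = centre G" "order Q * card (centre G) = order G" "finite (carrier Q)"
      by (rule quotient_nat_group[OF central_subgroup_normal[OF subgroup_centre] fin]) auto
    have "order Q dvd p ^ n" using Q(5) less.prems(3) by (metis dvd_triv_left)
    then obtain k where k: "order Q = p ^ k" using divides_primepow_nat[OF less.prems(2)] by blast
    moreover have "order Q > 0" using k less.prems(2) by (simp add: prime_gt_0_nat)
    then have "order Q < order G" using n_less_n_mult_m[OF _ c[unfolded One_nat_def], of "order Q"] Q(5) by simp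
    ultimately have "nilpotent_group Q" using less.hyps[OF _ Q(1) less.prems(2)] by blast
    then show ?thesis using nilpotent_central_extension[OF is_group _ Q(2)] Q(4) by simp
  qed
qed

text \<open>The commutator with a fixed element \<open>g\<close> carries an element that has order \<open>q\<close> and is
  central modulo the centre to a central element of order \<open>q\<close>.\<close>

lemma nilpotent_central_prime_order:
  fixes H :: "nat monoid"
  assumes "nilpotent_group H" "finite (carrier H)" "Factorial_Ring.prime q" "q dvd order H"
  shows "\<exists>c\<in>centre H. group.ord H c = q"
  using assms
proof (induction "order H" arbitrary: H rule: less_induct)
  case less
  interpret H: group H using less.prems by (simp add: nilpotent_group_def)
  have Z: "subgroup (centre H) H" by (rule H.subgroup_centre)
  have "order H \<noteq> 1" using less.prems(3,4) by auto
  then have "carrier H \<noteq> {\<one>\<^bsub>H\<^esub>}" by (auto simp: order_def)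
  then have c: "card (centre H) > 1"
    using card_centre_gt_1[OF H.is_group less.prems(2)] nilpotent_centre[OF less.prems(1)] by blast
  \<comment> \<open>If \<open>q\<close> divides the order of the centre, Cauchy's theorem applies
    there. Otherwise \<open>q\<close> divides the order of the quotient by the centre, and
    \<open>w\<close> below lifts a central element of order \<open>q\<close> of that
    quotient.\<close>
  show ?case
  proof (cases "q dvd card (centre H)")
    case True
    let ?Z = "H\<lparr>carrier := centre H\<rparr>"
    have gZ: "group ?Z" using H.subgroup_imp_group[OF Z] .
    have "finite (carrier ?Z)" using c by (auto intro: card_ge_0_finite)
    then obtain x where x: "x \<in> centre H" "group.ord ?Z x = q"
      using group.element_of_prime_order[OF gZ _ less.prems(3)] True by (auto simp: order_def)
    have xH: "x \<in> carrier H" using x(1) by (simp add: centre_def)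
    have "x [^]\<^bsub>H\<^esub> q = \<one>\<^bsub>H\<^esub>"
      using group.pow_ord_eq_1[OF gZ, of x] x
      by (subst H.nat_pow_consistent[of x q "centre H"]) simp
    moreover have "x \<noteq> \<one>\<^bsub>H\<^esub>"
      using group.ord_id[OF gZ] x(2) less.prems(3) by auto
    ultimately have "H.ord x = q"
      using H.pow_eq_id[OF xH] H.ord_eq_1[OF xH] less.prems(3) by (auto simp: prime_nat_iff)
    then show ?thesis using x(1) by blast
  next
    case False
    obtain Q :: "nat monoid" and f where Q: "group Q" "f \<in> hom H Q" "f ` carrier H = carrier Q"
      "kernel H Q f = centre H" "order Q * card (centre H) = order H" "finite (carrier Q)"
      by (rule quotient_nat_group[OF H.central_subgroup_normal[OF Z] less.prems(2)]) auto
    interpret f: group_hom H Q f using Q by (simp add: group_homI H.is_group)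
    have "order Q > 0" using Q(6) f.H.order_gt_0_iff_finite by blast
    then have "order Q < order H" using n_less_n_mult_m[OF _ c[unfolded One_nat_def], of "order Q"] Q(5) by simp
    moreover have "nilpotent_group Q" using nilpotent_surj less.prems(1) Q by blast
    moreover have "q dvd order Q" using Q(5) False less.prems(3,4) by (metis prime_dvd_mult_iff)
    ultimately obtain d where d: "d \<in> centre Q" "group.ord Q d = q"
      using less.hyps[of Q] less.prems(3) Q(6) by blast
    then obtain w where w: "w \<in> carrier H" "f w = d" using Q(3) centreD(1)[OF d(1)] by (metis imageE)
    have wq: "w [^]\<^bsub>H\<^esub> q \<in> centre H"
    proof -
      have "f (w [^]\<^bsub>H\<^esub> q) = \<one>\<^bsub>Q\<^esub>"
        using w d(2) f.H.pow_ord_eq_1[of d] centreD(1)[OF d(1)] f.hom_nat_pow by simp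
      then show ?thesis using Q(4) w by (auto simp: kernel_def)
    qed
    have "w \<notin> centre H"
    proof
      assume "w \<in> centre H"
      then have "d = \<one>\<^bsub>Q\<^esub>" using Q(4) w by (auto simp: kernel_def)
      then show False using d(2) f.H.ord_id less.prems(3) by auto
    qed
    then obtain g where g: "g \<in> carrier H" "w \<otimes>\<^bsub>H\<^esub> g \<otimes>\<^bsub>H\<^esub> inv\<^bsub>H\<^esub> w \<otimes>\<^bsub>H\<^esub> inv\<^bsub>H\<^esub> g \<noteq> \<one>\<^bsub>H\<^esub>"
      using H.centre_iff_commutator[OF w(1)] by blast
    define c where "c = w \<otimes>\<^bsub>H\<^esub> g \<otimes>\<^bsub>H\<^esub> inv\<^bsub>H\<^esub> w \<otimes>\<^bsub>H\<^esub> inv\<^bsub>H\<^esub> g"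
    have cH: "c \<in> carrier H" using w g by (simp add: c_def)
    have "f c = \<one>\<^bsub>Q\<^esub>"
      using w g d(1) f.H.centre_iff_commutator[of d] centreD(1)[OF d(1)] by (auto simp: c_def)
    then have cZ: "c \<in> centre H" using Q(4) cH by (auto simp: kernel_def)
    \<comment> \<open>Since \<open>c\<close> is central, the \<open>q\<close>-th power of
      \<open>w\<close> is that of \<open>c\<close> times that of a conjugate of \<open>w\<close>.
      The \<open>q\<close>-th power of \<open>w\<close> is central, so conjugation leaves it
      unchanged; cancelling it shows that the \<open>q\<close>-th power of \<open>c\<close> is
      trivial.\<close>
    have "w = c \<otimes>\<^bsub>H\<^esub> (g \<otimes>\<^bsub>H\<^esub> w \<otimes>\<^bsub>H\<^esub> inv\<^bsub>H\<^esub> g)"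
      using w g by (simp add: c_def H.m_assoc H.inv_mult_cancel)
    moreover have "(g \<otimes>\<^bsub>H\<^esub> w \<otimes>\<^bsub>H\<^esub> inv\<^bsub>H\<^esub> g) [^]\<^bsub>H\<^esub> q = w [^]\<^bsub>H\<^esub> q"
    proof -
      have "(g \<otimes>\<^bsub>H\<^esub> w \<otimes>\<^bsub>H\<^esub> inv\<^bsub>H\<^esub> g) [^]\<^bsub>H\<^esub> n = g \<otimes>\<^bsub>H\<^esub> w [^]\<^bsub>H\<^esub> n \<otimes>\<^bsub>H\<^esub> inv\<^bsub>H\<^esub> g" for n :: nat
      proof (induction n)
        case (Suc n)
        have "(g \<otimes>\<^bsub>H\<^esub> w [^]\<^bsub>H\<^esub> n \<otimes>\<^bsub>H\<^esub> inv\<^bsub>H\<^esub> g) \<otimes>\<^bsub>H\<^esub> (g \<otimes>\<^bsub>H\<^esub> w \<otimes>\<^bsub>H\<^esub> inv\<^bsub>H\<^esub> g) =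
            g \<otimes>\<^bsub>H\<^esub> w [^]\<^bsub>H\<^esub> n \<otimes>\<^bsub>H\<^esub> (inv\<^bsub>H\<^esub> g \<otimes>\<^bsub>H\<^esub> g) \<otimes>\<^bsub>H\<^esub> w \<otimes>\<^bsub>H\<^esub> inv\<^bsub>H\<^esub> g"
          using w g by (simp add: H.m_assoc H.inv_mult_cancel)
        then show ?case using Suc w g by (simp add: H.m_assoc)
      qed (use g in simp)
      moreover have "g \<otimes>\<^bsub>H\<^esub> w [^]\<^bsub>H\<^esub> q = w [^]\<^bsub>H\<^esub> q \<otimes>\<^bsub>H\<^esub> g" using centreD(2)[OF wq g(1)] by simp
      ultimately have "(g \<otimes>\<^bsub>H\<^esub> w \<otimes>\<^bsub>H\<^esub> inv\<^bsub>H\<^esub> g) [^]\<^bsub>H\<^esub> q = w [^]\<^bsub>H\<^esub> q \<otimes>\<^bsub>H\<^esub> g \<otimes>\<^bsub>H\<^esub> inv\<^bsub>H\<^esub> g"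
        by simp
      then show ?thesis using w g(1) by (simp add: H.m_assoc)
    qed
    moreover have "(c \<otimes>\<^bsub>H\<^esub> (g \<otimes>\<^bsub>H\<^esub> w \<otimes>\<^bsub>H\<^esub> inv\<^bsub>H\<^esub> g)) [^]\<^bsub>H\<^esub> q =
        c [^]\<^bsub>H\<^esub> q \<otimes>\<^bsub>H\<^esub> (g \<otimes>\<^bsub>H\<^esub> w \<otimes>\<^bsub>H\<^esub> inv\<^bsub>H\<^esub> g) [^]\<^bsub>H\<^esub> q"
      using cZ cH w g by (intro H.pow_mult_distrib centreD(2)[OF cZ]) auto
    ultimately have "c [^]\<^bsub>H\<^esub> q \<otimes>\<^bsub>H\<^esub> w [^]\<^bsub>H\<^esub> q = \<one>\<^bsub>H\<^esub> \<otimes>\<^bsub>H\<^esub> w [^]\<^bsub>H\<^esub> q" using w by simp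
    then have "c [^]\<^bsub>H\<^esub> q = \<one>\<^bsub>H\<^esub>" using cH w by simp
    moreover have "c \<noteq> \<one>\<^bsub>H\<^esub>" using g by (simp add: c_def)
    ultimately have "H.ord c = q"
      using H.pow_eq_id[OF cH] H.ord_eq_1[OF cH] less.prems(3) by (auto simp: prime_nat_iff)
    then show ?thesis using cZ by blast
  qed
qed

section \<open>Subgroups of nilpotent groups are subnormal\<close>

lemma subgroup_lower_central: "group G \<Longrightarrow> subgroup (lower_central G n) G"
proof (cases n)
  case (Suc m)
  assume G: "group G"
  then interpret group G .
  show ?thesis unfolding Suc lower_central.simps commutator_subgroup_def
    by (rule generate_is_subgroup) (use lower_central_closed[OF G, of m] in \<open>auto dest!: subsetD\<close>)
qed (simp add: group.subgroup_self)

text \<open>The normalizer is a stabilizer, so it demands that the conjugate of \<open>S\<close>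
  equals \<open>S\<close>. Conjugation by \<open>z\<close> gives one inclusion, conjugation by its
  inverse the other.\<close>

lemma (in group) normalizer_memI:
  assumes "S \<subseteq> carrier G" "z \<in> carrier G"
    "\<And>s. s \<in> S \<Longrightarrow> z \<otimes> s \<otimes> inv z \<in> S" "\<And>s. s \<in> S \<Longrightarrow> inv z \<otimes> s \<otimes> z \<in> S"
  shows "z \<in> normalizer G S"
proof -
  have "z <# S #> inv z = S"
  proof
    show "z <# S #> inv z \<subseteq> S" using assms(3) by (auto simp: l_coset_def r_coset_def)
    show "S \<subseteq> z <# S #> inv z"
    proof
      fix s assume s: "s \<in> S"
      then have "z \<otimes> (inv z \<otimes> s \<otimes> z) \<otimes> inv z = s"
        using subsetD[OF assms(1) s] assms(2) by (simp add: m_assoc inv_mult_cancel)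
      then show "s \<in> z <# S #> inv z"
        using assms(4)[OF s] unfolding l_coset_def r_coset_def by force
    qed
  qed
  then show ?thesis using assms(1,2) by (simp add: normalizer_def stabilizer_def)
qed

text \<open>The chain consists of iterated normalizers of \<open>S\<close>. It climbs at least as
  fast as the lower central series descends, so after \<open>n\<close> normalizers the whole group
  is reached.\<close>

lemma nilpotent_subgroup_subnormal:
  assumes "nilpotent_group G" "subgroup S G"
  shows "subnormal S G"
proof -
  interpret group G using assms(1) by (simp add: nilpotent_group_def)
  obtain n where n: "lower_central G n = {\<one>\<^bsub>G\<^esub>}" using assms(1) by (auto simp: nilpotent_group_def)
  define T where "T i = (normalizer G ^^ i) S" for i
  have T0: "T 0 = S" and TS: "T (Suc i) = normalizer G (T i)" for i by (simp_all add: T_def)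
  have sub: "subgroup (T i) G" for i
  proof (induction i)
    case (Suc i)
    then show ?case unfolding TS by (intro normalizer_imp_subgroup subgroup.subset)
  qed (simp add: T0 assms(2))
  have "lower_central G (n - i) \<subseteq> T i" if "i \<le> n" for i
    using that
  proof (induction i)
    case 0
    then show ?case using n subgroup.one_closed[OF sub[of 0]] by simp
  next
    case (Suc i)
    define m where "m = n - Suc i"
    have m: "n - i = Suc m" using Suc.prems by (simp add: m_def)
    have IH: "lower_central G (Suc m) \<subseteq> T i" using Suc m by simp
    have conj: "z \<otimes>\<^bsub>G\<^esub> s \<otimes>\<^bsub>G\<^esub> inv\<^bsub>G\<^esub> z \<in> T i" if z: "z \<in> lower_central G m" and s: "s \<in> T i" for z s
    proof -
      have zs: "z \<in> carrier G" "s \<in> carrier G"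
        using z lower_central_closed[OF is_group] s subgroup.mem_carrier[OF sub] by blast+
      \<comment> \<open>The conjugate of \<open>s\<close> by \<open>z\<close> is the commutator of
        \<open>z\<close> and \<open>s\<close> times \<open>s\<close>, and the commutator lies in the
        next term of the series, which \<open>T i\<close> already contains.\<close>
      have "z \<otimes>\<^bsub>G\<^esub> s \<otimes>\<^bsub>G\<^esub> inv\<^bsub>G\<^esub> z \<otimes>\<^bsub>G\<^esub> inv\<^bsub>G\<^esub> s \<in> lower_central G (Suc m)"
        unfolding lower_central.simps commutator_subgroup_def
        by (rule generate.incl) (use z zs in blast)
      then have "(z \<otimes>\<^bsub>G\<^esub> s \<otimes>\<^bsub>G\<^esub> inv\<^bsub>G\<^esub> z \<otimes>\<^bsub>G\<^esub> inv\<^bsub>G\<^esub> s) \<otimes>\<^bsub>G\<^esub> s \<in> T i"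
        using IH s subgroup.m_closed[OF sub] by blast
      then show ?thesis using zs by (simp add: m_assoc)
    qed
    have "lower_central G m \<subseteq> T (Suc i)"
    proof
      fix z assume z: "z \<in> lower_central G m"
      have zc: "z \<in> carrier G" using z lower_central_closed[OF is_group] by blast
      have "inv\<^bsub>G\<^esub> z \<in> lower_central G m"
        using subgroup.m_inv_closed[OF subgroup_lower_central[OF is_group] z] .
      then show "z \<in> T (Suc i)"
        unfolding TS using z zc conj[of z] conj[of "inv\<^bsub>G\<^esub> z"] subgroup.subset[OF sub[of i]]
        by (intro normalizer_memI) auto
    qed
    then show ?case by (simp add: m_def)
  qed
  from this[of n] have "T n = carrier G" using subgroup.subset[OF sub[of n]] by auto
  then show ?thesis
    unfolding subnormal_def using assms(2) sub T0 TS subgroup_in_normalizer[OF sub]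
    by (intro conjI exI[of _ n] exI[of _ T]) auto
qed

section \<open>Wreath products\<close>

text \<open>The regular wreath product. The pair \<open>(f, k)\<close> encodes the permutation
  \<open>(z, x) \<mapsto> (f x \<otimes> z, k \<otimes> x)\<close> of \<open>Z \<times> T\<close>; with this convention the product involves no
  inverses.\<close>

definition wreath :: "('a, 'c) monoid_scheme \<Rightarrow> ('b, 'd) monoid_scheme \<Rightarrow> (('b \<Rightarrow> 'a) \<times> 'b) monoid"
  where "wreath Z T =
    \<lparr>carrier = (carrier T \<rightarrow>\<^sub>E carrier Z) \<times> carrier T,
     monoid.mult = (\<lambda>u v. (\<lambda>x\<in>carrier T. fst u (snd v \<otimes>\<^bsub>T\<^esub> x) \<otimes>\<^bsub>Z\<^esub> fst v x, snd u \<otimes>\<^bsub>T\<^esub> snd v)),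
     one = (\<lambda>x\<in>carrier T. \<one>\<^bsub>Z\<^esub>, \<one>\<^bsub>T\<^esub>)\<rparr>"

lemma carrier_wreath: "carrier (wreath Z T) = (carrier T \<rightarrow>\<^sub>E carrier Z) \<times> carrier T"
  and mult_wreath: "(f, k) \<otimes>\<^bsub>wreath Z T\<^esub> (g, l) =
    (\<lambda>x\<in>carrier T. f (l \<otimes>\<^bsub>T\<^esub> x) \<otimes>\<^bsub>Z\<^esub> g x, k \<otimes>\<^bsub>T\<^esub> l)"
  and one_wreath: "\<one>\<^bsub>wreath Z T\<^esub> = (\<lambda>x\<in>carrier T. \<one>\<^bsub>Z\<^esub>, \<one>\<^bsub>T\<^esub>)"
  by (simp_all add: wreath_def)

locale wreath_product = Z: group Z + T: group T
  for Z :: "('a, 'c) monoid_scheme" and T :: "('b, 'd) monoid_scheme"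
begin

abbreviation "W \<equiv> wreath Z T"

lemma inv_wreath_aux:
  assumes "f \<in> carrier T \<rightarrow>\<^sub>E carrier Z" "k \<in> carrier T"
  shows "(\<lambda>x\<in>carrier T. inv\<^bsub>Z\<^esub> f (inv\<^bsub>T\<^esub> k \<otimes>\<^bsub>T\<^esub> x), inv\<^bsub>T\<^esub> k) \<in> carrier W"
    and "(\<lambda>x\<in>carrier T. inv\<^bsub>Z\<^esub> f (inv\<^bsub>T\<^esub> k \<otimes>\<^bsub>T\<^esub> x), inv\<^bsub>T\<^esub> k) \<otimes>\<^bsub>W\<^esub> (f, k) = \<one>\<^bsub>W\<^esub>"
proof -
  have f: "f x \<in> carrier Z" if "x \<in> carrier T" for x using assms(1) that by blast
  show "(\<lambda>x\<in>carrier T. inv\<^bsub>Z\<^esub> f (inv\<^bsub>T\<^esub> k \<otimes>\<^bsub>T\<^esub> x), inv\<^bsub>T\<^esub> k) \<in> carrier W"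
    using assms(2) f by (auto simp: carrier_wreath)
  show "(\<lambda>x\<in>carrier T. inv\<^bsub>Z\<^esub> f (inv\<^bsub>T\<^esub> k \<otimes>\<^bsub>T\<^esub> x), inv\<^bsub>T\<^esub> k) \<otimes>\<^bsub>W\<^esub> (f, k) = \<one>\<^bsub>W\<^esub>"
    using assms(2) f by (auto simp: mult_wreath one_wreath T.inv_mult_cancel cong: restrict_cong)
qed

lemma group_wreath: "group W"
proof (rule groupI)
  fix u v assume "u \<in> carrier W" "v \<in> carrier W"
  then show "u \<otimes>\<^bsub>W\<^esub> v \<in> carrier W"
    by (cases u; cases v) (auto simp: carrier_wreath mult_wreath intro!: Z.m_closed)
next
  fix u v w assume "u \<in> carrier W" "v \<in> carrier W" "w \<in> carrier W"
  then obtain f k g l h m where "u = (f, k)" "v = (g, l)" "w = (h, m)"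
    and c: "f \<in> carrier T \<rightarrow>\<^sub>E carrier Z" "g \<in> carrier T \<rightarrow>\<^sub>E carrier Z" "h \<in> carrier T \<rightarrow>\<^sub>E carrier Z"
      "k \<in> carrier T" "l \<in> carrier T" "m \<in> carrier T"
    by (auto simp: carrier_wreath)
  moreover have "f x \<in> carrier Z" "g x \<in> carrier Z" "h x \<in> carrier Z" if "x \<in> carrier T" for x
    using c that by blast+
  ultimately show "u \<otimes>\<^bsub>W\<^esub> v \<otimes>\<^bsub>W\<^esub> w = u \<otimes>\<^bsub>W\<^esub> (v \<otimes>\<^bsub>W\<^esub> w)"
    by (auto simp: mult_wreath T.m_assoc Z.m_assoc cong: restrict_cong)
next
  fix u assume "u \<in> carrier W"
  then obtain f k where u: "u = (f, k)" and c: "f \<in> carrier T \<rightarrow>\<^sub>E carrier Z" "k \<in> carrier T"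
    by (auto simp: carrier_wreath)
  have f: "f x \<in> carrier Z" if "x \<in> carrier T" for x using c(1) that by blast
  have "(\<lambda>x\<in>carrier T. \<one>\<^bsub>Z\<^esub> \<otimes>\<^bsub>Z\<^esub> f x) = f"
    using c(1) f by (intro ext) (auto simp: restrict_def PiE_def extensional_def)
  then show "\<one>\<^bsub>W\<^esub> \<otimes>\<^bsub>W\<^esub> u = u"
    using c by (simp add: u one_wreath mult_wreath cong: restrict_cong)
  show "\<exists>v\<in>carrier W. v \<otimes>\<^bsub>W\<^esub> u = \<one>\<^bsub>W\<^esub>"
    using inv_wreath_aux[OF c] unfolding u by blast
qed (simp add: one_wreath carrier_wreath)

sublocale W: group W by (rule group_wreath)

lemma inv_wreath:
  assumes "f \<in> carrier T \<rightarrow>\<^sub>E carrier Z" "k \<in> carrier T"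
  shows "inv\<^bsub>W\<^esub> (f, k) = (\<lambda>x\<in>carrier T. inv\<^bsub>Z\<^esub> f (inv\<^bsub>T\<^esub> k \<otimes>\<^bsub>T\<^esub> x), inv\<^bsub>T\<^esub> k)"
  using W.inv_equality[OF inv_wreath_aux(2)[OF assms] _ inv_wreath_aux(1)[OF assms]] assms
  by (simp add: carrier_wreath)

lemma order_wreath: "finite (carrier T) \<Longrightarrow> order W = order Z ^ order T * order T"
  by (simp add: order_def carrier_wreath card_cartesian_product card_funcsetE)

lemma top_hom: "(\<lambda>u. (\<lambda>x\<in>carrier T. \<one>\<^bsub>Z\<^esub>, u)) \<in> hom T W"
  by (auto simp: hom_def carrier_wreath mult_wreath cong: restrict_cong)

lemma snd_hom: "snd \<in> hom W T"
  by (auto simp: hom_def carrier_wreath mult_wreath)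

text \<open>Separates top and base parts, so that membership in the verbal subgroup can be proved
  for each of them alone.\<close>

lemma top_mult_base:
  assumes "f \<in> carrier T \<rightarrow>\<^sub>E carrier Z" "k \<in> carrier T"
  shows "(\<lambda>x\<in>carrier T. \<one>\<^bsub>Z\<^esub>, k) \<otimes>\<^bsub>W\<^esub> (f, \<one>\<^bsub>T\<^esub>) = (f, k)"
proof -
  have "(\<lambda>x\<in>carrier T. \<one>\<^bsub>Z\<^esub> \<otimes>\<^bsub>Z\<^esub> f x) = f"
  proof
    fix x show "(\<lambda>x\<in>carrier T. \<one>\<^bsub>Z\<^esub> \<otimes>\<^bsub>Z\<^esub> f x) x = f x"
      using PiE_mem[OF assms(1), of x] PiE_arb[OF assms(1), of x] by (cases "x \<in> carrier T") simp_all
  qed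
  then show ?thesis using assms by (simp add: mult_wreath cong: restrict_cong)
qed

text \<open>The base group element \<open>F\<close> is the commutator of \<open>l\<close> with \<open>f\<close>.\<close>

lemma base_in_verbal_subgroup:
  assumes "V \<subseteq> carrier F_inf" "l \<in> verbal_subgroup V T"
    and f: "f \<in> carrier T \<rightarrow>\<^sub>E carrier Z" and F: "F \<in> carrier T \<rightarrow>\<^sub>E carrier Z"
    and eq: "\<And>x. x \<in> carrier T \<Longrightarrow> F (l \<otimes>\<^bsub>T\<^esub> x) \<otimes>\<^bsub>Z\<^esub> f (l \<otimes>\<^bsub>T\<^esub> x) = f x"
  shows "(F, \<one>\<^bsub>T\<^esub>) \<in> verbal_subgroup V W"
proof -
  let ?V = "verbal_subgroup V W"
  have sub: "subgroup ?V W" by (rule verbal_subgroup_subgroup[OF W.is_group assms(1)])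
  define a where "a = (\<lambda>x\<in>carrier T. \<one>\<^bsub>Z\<^esub>, l)"
  define b where "b = (f, \<one>\<^bsub>T\<^esub>)"
  have l: "l \<in> carrier T"
    using subgroup.mem_carrier[OF verbal_subgroup_subgroup[OF T.is_group assms(1)] assms(2)] .
  have a: "a \<in> ?V"
    unfolding a_def by (rule hom_verbal_subgroup[OF T.is_group W.is_group top_hom assms(1,2)])
  have aW: "a \<in> carrier W" using subgroup.mem_carrier[OF sub a] .
  have bW: "b \<in> carrier W" and FW: "(F, \<one>\<^bsub>T\<^esub>) \<in> carrier W" using f F by (auto simp: b_def carrier_wreath)
  have fc: "f x \<in> carrier Z" if "x \<in> carrier T" for x using f that by blast
  \<comment> \<open>Conjugation by \<open>b\<close> is an endomorphism and hence preserves the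
    verbal subgroup. So the commutator of \<open>a\<close> with \<open>b\<close> lies there although
    \<open>b\<close> itself may not.\<close>
  have "(\<lambda>u. b \<otimes>\<^bsub>W\<^esub> u \<otimes>\<^bsub>W\<^esub> inv\<^bsub>W\<^esub> b) \<in> hom W W"
    using bW by (intro homI) (simp_all add: W.m_assoc W.inv_mult_cancel)
  then have conj: "b \<otimes>\<^bsub>W\<^esub> inv\<^bsub>W\<^esub> a \<otimes>\<^bsub>W\<^esub> inv\<^bsub>W\<^esub> b \<in> ?V"
    using hom_verbal_subgroup[OF W.is_group W.is_group _ assms(1) subgroup.m_inv_closed[OF sub a]]
    by blast
  \<comment> \<open>Multiplying \<open>b\<close> by \<open>a\<close> on the right shifts the
    argument of \<open>f\<close> by \<open>l\<close>, so this is the hypothesis \<open>eq\<close>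
    read coordinatewise.\<close>
  have "(F, \<one>\<^bsub>T\<^esub>) \<otimes>\<^bsub>W\<^esub> (b \<otimes>\<^bsub>W\<^esub> a) = a \<otimes>\<^bsub>W\<^esub> b"
    using l fc eq by (simp add: a_def b_def mult_wreath cong: restrict_cong)
  then have "(F, \<one>\<^bsub>T\<^esub>) = a \<otimes>\<^bsub>W\<^esub> b \<otimes>\<^bsub>W\<^esub> inv\<^bsub>W\<^esub> (b \<otimes>\<^bsub>W\<^esub> a)"
    using aW bW FW by (simp add: W.inv_solve_right)
  also have "\<dots> = a \<otimes>\<^bsub>W\<^esub> (b \<otimes>\<^bsub>W\<^esub> inv\<^bsub>W\<^esub> a \<otimes>\<^bsub>W\<^esub> inv\<^bsub>W\<^esub> b)"
    using aW bW by (simp add: W.m_assoc W.inv_mult_group)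
  finally show ?thesis using subgroup.m_closed[OF sub a conj] by simp
qed

end

text \<open>The Kaloujnine--Krasner embedding of \<open>H\<close> into a wreath product of the kernel with \<open>K\<close>,
  twisted in the second coordinate: at \<open>(k, m)\<close> it takes the inverse of the value of the
  cocycle for \<open>m = \<one>\<close>, the value itself for \<open>m = l\<close>, and is trivial elsewhere. This puts the base
  component into the image of the commutator with \<open>l\<close>. The kernel is required to be central so
  that inversion of the cocycle is multiplicative.\<close>

lemma wreath_embedding_into_verbal_subgroup:
  assumes H: "group H" and K: "group K" and L: "group L" and V: "V \<subseteq> carrier F_inf"
    and phi: "\<phi> \<in> hom H K" and N: "kernel H K \<phi> = N" "N \<subseteq> centre H"
    and phiV: "\<phi> ` carrier H \<subseteq> verbal_subgroup V K"
    and l: "l \<in> verbal_subgroup V L" "l \<noteq> \<one>\<^bsub>L\<^esub>"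
  shows "\<exists>e\<in>hom H (wreath (H\<lparr>carrier := N\<rparr>) (K \<times>\<times> L)).
    inj_on e (carrier H) \<and>
    e ` carrier H \<subseteq> verbal_subgroup V (wreath (H\<lparr>carrier := N\<rparr>) (K \<times>\<times> L))"
proof -
  let ?Z = "H\<lparr>carrier := N\<rparr>" and ?T = "K \<times>\<times> L"
  interpret phi: group_hom H K \<phi> using H K phi by (simp add: group_homI)
  interpret L: group L by fact
  have subN: "subgroup N H" using phi.subgroup_kernel N(1) by simp
  have Z: "group ?Z" using phi.G.subgroup_imp_group[OF subN] .
  interpret W: wreath_product ?Z ?T
    using Z DirProd_group[OF K L] by (simp add: wreath_product_def)
  let ?VW = "verbal_subgroup V (wreath ?Z ?T)"
  have lL: "l \<in> carrier L"
    using subgroup.mem_carrier[OF verbal_subgroup_subgroup[OF L V] l(1)] .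
  define K' where "K' = \<phi> ` carrier H"
  have subK': "subgroup K' K"
    unfolding K'_def by (rule phi.img_is_subgroup)
  \<comment> \<open>The map \<phi> need not be onto \<open>K\<close>, so representatives of the
    right cosets of its image are chosen. The choice depends on the coset only.\<close>
  define r where "r c = (SOME x. x \<in> K' #>\<^bsub>K\<^esub> c)" for c
  have r: "r c \<in> K' #>\<^bsub>K\<^esub> c" if "c \<in> carrier K" for c
    unfolding r_def by (rule someI[of _ c]) (rule phi.H.rcos_self[OF that subK'])
  \<comment> \<open>Lifts to \<open>H\<close> the part of \<open>c\<close> that lies in the image of
    \<phi>, that is, \<open>c\<close> without its coset representative.\<close>
  define t where "t c = (SOME h. h \<in> carrier H \<and> \<phi> h \<otimes>\<^bsub>K\<^esub> r c = c)" for c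
  have t: "t c \<in> carrier H \<and> \<phi> (t c) \<otimes>\<^bsub>K\<^esub> r c = c" if c: "c \<in> carrier K" for c
  proof -
    obtain h where h: "h \<in> carrier H" "r c = \<phi> h \<otimes>\<^bsub>K\<^esub> c"
      using r[OF c] by (auto simp: r_coset_def K'_def)
    then have "inv\<^bsub>H\<^esub> h \<in> carrier H \<and> \<phi> (inv\<^bsub>H\<^esub> h) \<otimes>\<^bsub>K\<^esub> r c = c"
      using c by (simp add: phi.H.inv_mult_cancel)
    then show ?thesis unfolding t_def by (rule someI)
  qed
  have rc: "r c \<in> carrier K" if c: "c \<in> carrier K" for c
    using r[OF c] phi.H.r_coset_subset_G[OF subgroup.subset[OF subK'] c] by blast
  have r_eq: "r (\<phi> h \<otimes>\<^bsub>K\<^esub> c) = r c" if "h \<in> carrier H" "c \<in> carrier K" for h c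
  proof -
    have "\<phi> h \<in> K'" using that by (simp add: K'_def)
    then have "K' #>\<^bsub>K\<^esub> (\<phi> h \<otimes>\<^bsub>K\<^esub> c) = K' #>\<^bsub>K\<^esub> c"
      using phi.H.coset_mult_assoc[of K' "\<phi> h" c] phi.H.coset_join2[of "\<phi> h" K'] that subK'
      by (simp add: subgroup.subset)
    then show ?thesis by (simp add: r_def)
  qed
  have t_eq: "\<phi> (t (\<phi> h \<otimes>\<^bsub>K\<^esub> c)) = \<phi> h \<otimes>\<^bsub>K\<^esub> \<phi> (t c)" if h: "h \<in> carrier H" and c: "c \<in> carrier K" for h c
  proof -
    have "\<phi> (t (\<phi> h \<otimes>\<^bsub>K\<^esub> c)) \<otimes>\<^bsub>K\<^esub> r c = \<phi> h \<otimes>\<^bsub>K\<^esub> c"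
      using t[of "\<phi> h \<otimes>\<^bsub>K\<^esub> c"] r_eq[OF h c] h c by simp
    also have "\<dots> = \<phi> h \<otimes>\<^bsub>K\<^esub> \<phi> (t c) \<otimes>\<^bsub>K\<^esub> r c"
      using t[OF c] rc[OF c] h c by (simp add: phi.H.m_assoc)
    finally show ?thesis
      using t[of "\<phi> h \<otimes>\<^bsub>K\<^esub> c"] t[OF c] rc[OF c] h c by simp
  qed
  \<comment> \<open>The cocycle of the Kaloujnine-Krasner embedding. By \<open>t_eq\<close> its
    values are killed by \<phi>, so they lie in \<open>N\<close>.\<close>
  define \<alpha> where "\<alpha> h c = inv\<^bsub>H\<^esub> t (\<phi> h \<otimes>\<^bsub>K\<^esub> c) \<otimes>\<^bsub>H\<^esub> h \<otimes>\<^bsub>H\<^esub> t c" for h c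
  have \<alpha>N: "\<alpha> h c \<in> N" if h: "h \<in> carrier H" and c: "c \<in> carrier K" for h c
  proof -
    have "\<alpha> h c \<in> carrier H" "\<phi> (\<alpha> h c) = \<one>\<^bsub>K\<^esub>"
      using t[of "\<phi> h \<otimes>\<^bsub>K\<^esub> c"] t[OF c] t_eq[OF h c] h c
      by (simp_all add: \<alpha>_def phi.H.inv_mult_group phi.H.m_assoc phi.H.inv_mult_cancel)
    then show ?thesis using N(1) by (auto simp: kernel_def)
  qed
  have NH: "z \<in> carrier H" if "z \<in> N" for z using subgroup.mem_carrier[OF subN that] .
  \<comment> \<open>The cocycle identity: the lifts in the middle cancel. Its shifted argument
    matches the base component of a product in the wreath product.\<close>
  have \<alpha>_mult: "\<alpha> (h \<otimes>\<^bsub>H\<^esub> h') c = \<alpha> h (\<phi> h' \<otimes>\<^bsub>K\<^esub> c) \<otimes>\<^bsub>H\<^esub> \<alpha> h' c"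
    if "h \<in> carrier H" "h' \<in> carrier H" "c \<in> carrier K" for h h' c
    using that t[of c] t[of "\<phi> h' \<otimes>\<^bsub>K\<^esub> c"] t[of "\<phi> h \<otimes>\<^bsub>K\<^esub> (\<phi> h' \<otimes>\<^bsub>K\<^esub> c)"]
    by (simp add: \<alpha>_def phi.G.m_assoc phi.H.m_assoc phi.G.inv_mult_cancel)
  have \<alpha>_inv_mult: "inv\<^bsub>H\<^esub> \<alpha> (h \<otimes>\<^bsub>H\<^esub> h') c =
      inv\<^bsub>H\<^esub> \<alpha> h (\<phi> h' \<otimes>\<^bsub>K\<^esub> c) \<otimes>\<^bsub>H\<^esub> inv\<^bsub>H\<^esub> \<alpha> h' c"
    if "h \<in> carrier H" "h' \<in> carrier H" "c \<in> carrier K" for h h' c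
  proof -
    let ?a = "\<alpha> h (\<phi> h' \<otimes>\<^bsub>K\<^esub> c)" and ?b = "\<alpha> h' c"
    have ab: "?a \<in> N" "?b \<in> N" using that by (auto intro: \<alpha>N)
    have "?a \<otimes>\<^bsub>H\<^esub> ?b = ?b \<otimes>\<^bsub>H\<^esub> ?a"
      using centreD(2)[OF subsetD[OF N(2) ab(1)] NH[OF ab(2)]] .
    then show ?thesis
      using \<alpha>_mult[OF that] NH[OF ab(1)] NH[OF ab(2)] by (simp add: phi.G.inv_mult_group)
  qed
  \<comment> \<open>On the central kernel the cocycle returns its first argument. Hence the base
    component of \<open>e h\<close> at \<open>l\<close> recovers \<open>h\<close>, which gives
    injectivity.\<close>
  have \<alpha>_N: "\<alpha> h c = h" if h: "h \<in> N" and c: "c \<in> carrier K" for h c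
  proof -
    have "h \<in> carrier H" "\<phi> h = \<one>\<^bsub>K\<^esub>" using h N(1) by (auto simp: kernel_def)
    moreover have "h \<otimes>\<^bsub>H\<^esub> t c = t c \<otimes>\<^bsub>H\<^esub> h" using centreD(2)[OF subsetD[OF N(2) h]] t[OF c] by blast
    ultimately show ?thesis using t[OF c] c by (simp add: \<alpha>_def phi.G.m_assoc phi.G.inv_mult_cancel)
  qed
  define b where "b h = (\<lambda>x\<in>carrier ?T. if snd x = \<one>\<^bsub>L\<^esub> then inv\<^bsub>H\<^esub> \<alpha> h (fst x)
    else if snd x = l then \<alpha> h (fst x) else \<one>\<^bsub>H\<^esub>)" for h
  define e where "e h = (b h, (\<phi> h, \<one>\<^bsub>L\<^esub>))" for h
  have oneN: "\<one>\<^bsub>H\<^esub> \<in> N" using subgroup.one_closed[OF subN] .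
  have invN: "inv\<^bsub>H\<^esub> z \<in> N" if "z \<in> N" for z using subgroup.m_inv_closed[OF subN that] .
  have b: "b h \<in> carrier ?T \<rightarrow>\<^sub>E carrier ?Z" if "h \<in> carrier H" for h
    using that by (auto simp: b_def oneN intro!: invN \<alpha>N)
  have "e \<in> hom H (wreath ?Z ?T)"
  proof (rule homI)
    fix h assume "h \<in> carrier H"
    then show "e h \<in> carrier (wreath ?Z ?T)" using b by (simp add: e_def carrier_wreath)
  next
    fix h h' assume h: "h \<in> carrier H" and h': "h' \<in> carrier H"
    have "b (h \<otimes>\<^bsub>H\<^esub> h') = (\<lambda>x\<in>carrier ?T. b h ((\<phi> h', \<one>\<^bsub>L\<^esub>) \<otimes>\<^bsub>?T\<^esub> x) \<otimes>\<^bsub>?Z\<^esub> b h' x)"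
    proof
      fix x show "b (h \<otimes>\<^bsub>H\<^esub> h') x =
        (\<lambda>x\<in>carrier ?T. b h ((\<phi> h', \<one>\<^bsub>L\<^esub>) \<otimes>\<^bsub>?T\<^esub> x) \<otimes>\<^bsub>?Z\<^esub> b h' x) x"
        using h h' \<alpha>_mult[OF h h', of "fst x"] \<alpha>_inv_mult[OF h h', of "fst x"]
        by (cases x) (auto simp: b_def)
    qed
    then show "e (h \<otimes>\<^bsub>H\<^esub> h') = e h \<otimes>\<^bsub>wreath ?Z ?T\<^esub> e h'"
      using h h' by (simp add: e_def mult_wreath)
  qed
  moreover have "inj_on e (carrier H)"
  proof -
    interpret e: group_hom H "wreath ?Z ?T" e
      using calculation by (simp add: group_homI H W.group_wreath)
    have "h = \<one>\<^bsub>H\<^esub>" if h: "h \<in> carrier H" and eh: "e h = \<one>\<^bsub>wreath ?Z ?T\<^esub>" for h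
    proof -
      have "\<phi> h = \<one>\<^bsub>K\<^esub>" and bh: "b h = (\<lambda>x\<in>carrier ?T. \<one>\<^bsub>H\<^esub>)" using eh by (auto simp: e_def one_wreath)
      then have hN: "h \<in> N" using h N(1) by (auto simp: kernel_def)
      have "b h (\<one>\<^bsub>K\<^esub>, l) = \<one>\<^bsub>H\<^esub>" unfolding bh using lL by simp
      moreover have "b h (\<one>\<^bsub>K\<^esub>, l) = \<alpha> h \<one>\<^bsub>K\<^esub>" using lL l(2) by (simp add: b_def)
      ultimately show ?thesis using \<alpha>_N[OF hN, of "\<one>\<^bsub>K\<^esub>"] by simp
    qed
    then show ?thesis unfolding e.inj_iff_trivial_ker by (auto simp: kernel_def)
  qed
  moreover have "e h \<in> ?VW" if h: "h \<in> carrier H" for h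
  proof -
    \<comment> \<open>The base element whose commutator with \<open>l\<close> is \<open>b h\<close>.
      It carries the cocycle where the second coordinate is \<one>; the shift by \<open>l\<close>
      produces the two nontrivial layers of \<open>b h\<close>.\<close>
    define f where "f = (\<lambda>x\<in>carrier ?T. if snd x = \<one>\<^bsub>L\<^esub> then \<alpha> h (fst x) else \<one>\<^bsub>H\<^esub>)"
    have f: "f \<in> carrier ?T \<rightarrow>\<^sub>E carrier ?Z"
      using h by (auto simp: f_def oneN intro!: \<alpha>N)
    have VT: "(\<one>\<^bsub>K\<^esub>, l) \<in> verbal_subgroup V ?T" "(\<phi> h, \<one>\<^bsub>L\<^esub>) \<in> verbal_subgroup V ?T"
      using hom_verbal_subgroup[OF L W.T.is_group _ V l(1), of "\<lambda>x. (\<one>\<^bsub>K\<^esub>, x)"]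
        hom_verbal_subgroup[OF K W.T.is_group _ V, of "\<lambda>x. (x, \<one>\<^bsub>L\<^esub>)" "\<phi> h"] phiV h
      by (auto simp: hom_def)
    have "b h ((\<one>\<^bsub>K\<^esub>, l) \<otimes>\<^bsub>?T\<^esub> x) \<otimes>\<^bsub>?Z\<^esub> f ((\<one>\<^bsub>K\<^esub>, l) \<otimes>\<^bsub>?T\<^esub> x) = f x" if x: "x \<in> carrier ?T" for x
    proof -
      obtain k m where km: "x = (k, m)" "k \<in> carrier K" "m \<in> carrier L" using x by auto
      have "l \<otimes>\<^bsub>L\<^esub> m = l \<longleftrightarrow> m = \<one>\<^bsub>L\<^esub>" using lL km(3) by simp
      moreover have "l \<otimes>\<^bsub>L\<^esub> m = \<one>\<^bsub>L\<^esub> \<Longrightarrow> m \<noteq> \<one>\<^bsub>L\<^esub>" using lL l(2) by auto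
      moreover have "\<alpha> h k \<in> carrier H" using NH[OF \<alpha>N[OF h km(2)]] .
      ultimately show ?thesis using km lL l(2) by (auto simp: b_def f_def)
    qed
    then have "(b h, \<one>\<^bsub>?T\<^esub>) \<in> ?VW"
      using W.base_in_verbal_subgroup[OF V VT(1) f b[OF h]] by blast
    moreover have "(\<lambda>x\<in>carrier ?T. \<one>\<^bsub>H\<^esub>, (\<phi> h, \<one>\<^bsub>L\<^esub>)) \<in> ?VW"
      using hom_verbal_subgroup[OF W.T.is_group W.group_wreath W.top_hom V VT(2)] by simp
    moreover have "(\<lambda>x\<in>carrier ?T. \<one>\<^bsub>H\<^esub>, (\<phi> h, \<one>\<^bsub>L\<^esub>)) \<otimes>\<^bsub>wreath ?Z ?T\<^esub> (b h, \<one>\<^bsub>?T\<^esub>) = e h"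
      using W.top_mult_base[OF b[OF h], of "(\<phi> h, \<one>\<^bsub>L\<^esub>)"] h by (simp add: e_def)
    ultimately show ?thesis
      using subgroup.m_closed[OF verbal_subgroup_subgroup[OF W.group_wreath V]] by metis
  qed
  ultimately show ?thesis by blast
qed

section \<open>Free groups are residually p-finite\<close>

text \<open>The induction extends \<open>T\<close> to the wreath product of \<open>\<int>/p\<close> by \<open>T\<close>. When a letter \<open>x\<close> is
  prepended to \<open>w\<close>, only the value of its generator receives a nontrivial base component. That
  component is chosen such that applying \<open>x\<close> increases the base component of a value, evaluated
  at \<open>\<one>\<close>, by the old \<open>u\<close>; this value is the new \<open>u\<close>. Applying the inverse letter decreases it by
  the old \<open>u\<close> of the resulting suffix, which is nonzero only at \<open>w\<close> itself, and there
  reducedness excludes the inverse letter.\<close>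

lemma reduced_word_separated:
  fixes w :: "'i letter list"
  assumes p: "Factorial_Ring.prime (p::nat)" and w: "reduced w"
  shows "\<exists>(T :: nat monoid) n f u. group T \<and> order T = p ^ n \<and> range f \<subseteq> carrier T \<and>
    (\<forall>x\<in>carrier T. u x \<in> carrier (integer_mod_group p)) \<and>
    u (word_value T f w) = 1 \<and> (\<forall>a b. w = a @ b \<and> a \<noteq> [] \<longrightarrow> u (word_value T f b) = 0)"
  using w
proof (induction w)
  case Nil
  \<comment> \<open>The empty word has no proper suffix, so the trivial group with the constant
    \<open>u\<close> equal to 1 will do.\<close>
  define T :: "nat monoid" where "T = singleton_group 0"
  have "order T = p ^ 0" by (simp add: T_def order_def)
  moreover have "(1::int) \<in> carrier (integer_mod_group p)" using p by auto
  ultimately show ?case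
    by (intro exI[of _ T] exI[of _ 0] exI[of _ "\<lambda>_. 0"] exI[of _ "\<lambda>_. 1"]) (simp add: T_def)
next
  case (Cons x w)
  let ?Z = "integer_mod_group p"
  have p0: "p > 0" "p > 1" using prime_gt_1_nat[OF p] by auto
  have "reduced w" using Cons.prems by (rule reduced_ConsD)
  then obtain T :: "nat monoid" and n f u where T: "group T" "order T = p ^ n" "range f \<subseteq> carrier T"
    and uZ: "\<forall>x\<in>carrier T. u x \<in> carrier ?Z"
    and uw: "u (word_value T f w) = 1"
    and suf: "\<forall>a b. w = a @ b \<and> a \<noteq> [] \<longrightarrow> u (word_value T f b) = 0"
    using Cons.IH[OF \<open>reduced w\<close>] by (elim exE conjE) (rule that)
  have u: "u x \<in> carrier ?Z" if "x \<in> carrier T" for x using uZ that by blast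
  interpret W: wreath_product ?Z T using T(1) by (simp add: wreath_product_def)
  let ?W = "wreath ?Z T"
  obtain i s where x: "x = (i, s)" by (cases x)
  have fT: "f j \<in> carrier T" for j using T(3) by auto
  have finT: "finite (carrier T)" using T(2) p0 W.T.order_gt_0_iff_finite by simp
  \<comment> \<open>If \<open>x\<close> is an inverse letter, the generator gets the shifted inverse
    of \<open>u\<close>; inverting it in the wreath product then gives base component
    \<open>u\<close>. So in both cases it is the letter \<open>x\<close> that adds
    \<open>u\<close>.\<close>
  define \<delta> where "\<delta> j = (\<lambda>y\<in>carrier T. if j \<noteq> i then 0 else if s then u y
    else inv\<^bsub>?Z\<^esub> u (f i \<otimes>\<^bsub>T\<^esub> y))" for j
  define f' where "f' j = (\<delta> j, f j)" for j
  have \<delta>: "\<delta> j \<in> carrier T \<rightarrow>\<^sub>E carrier ?Z" for j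
    using u fT by (auto simp: \<delta>_def simp del: inv_integer_mod_group intro!: W.Z.inv_closed)
  have f'W: "f' j \<in> carrier ?W" for j using \<delta> fT by (simp add: f'_def carrier_wreath)
  then have f': "range f' \<subseteq> carrier ?W" by auto
  define v where "v b = word_value T f b" for b
  define g where "g b = fst (word_value ?W f' b) \<one>\<^bsub>T\<^esub>" for b
  have v: "v b \<in> carrier T" for b unfolding v_def by (rule W.T.word_value_closed[OF T(3)])
  have snd: "snd (word_value ?W f' b) = v b" for b
    using hom_word_value[OF W.group_wreath T(1) W.snd_hom f', of b]
    by (simp add: v_def f'_def o_def)
  have val: "word_value ?W f' b = (fst (word_value ?W f' b), v b)" for b
    using snd[of b] by (metis prod.collapse)
  have gZ: "g b \<in> carrier ?Z" for b
    using W.W.word_value_closed[OF f', of b] unfolding g_def by (subst (asm) val) (auto simp: carrier_wreath)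
  have v_Cons: "v ((j, s') # b) = (if s' then f j else inv\<^bsub>T\<^esub> f j) \<otimes>\<^bsub>T\<^esub> v b" for j s' b
    unfolding v_def by (rule W.T.word_value_Cons)
  \<comment> \<open>The product shifts the argument of its left factor by the top component of the
    right one. Evaluation at \<one> therefore reads the base component of the letter
    \<open>y\<close> at \<open>v b\<close>.\<close>
  have step: "g (y # b) = (if y = x then u (v b) else if y = inv_letter x then inv\<^bsub>?Z\<^esub> u (v (y # b)) else 0)
      \<otimes>\<^bsub>?Z\<^esub> g b" for y b
  proof -
    obtain j s' where y: "y = (j, s')" by (cases y)
    have "word_value ?W f' (y # b) = (if s' then f' j else inv\<^bsub>?W\<^esub> f' j) \<otimes>\<^bsub>?W\<^esub> word_value ?W f' b"
      unfolding y by (rule W.W.word_value_Cons)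
    also have "(if s' then f' j else inv\<^bsub>?W\<^esub> f' j) =
        (if s' then \<delta> j else (\<lambda>x\<in>carrier T. inv\<^bsub>?Z\<^esub> \<delta> j (inv\<^bsub>T\<^esub> f j \<otimes>\<^bsub>T\<^esub> x)), if s' then f j else inv\<^bsub>T\<^esub> f j)"
      using W.inv_wreath[OF \<delta> fT] by (simp add: f'_def)
    finally have "g (y # b) =
        (if s' then \<delta> j (v b) else inv\<^bsub>?Z\<^esub> \<delta> j (inv\<^bsub>T\<^esub> f j \<otimes>\<^bsub>T\<^esub> v b)) \<otimes>\<^bsub>?Z\<^esub> g b"
      unfolding g_def by (subst (asm) val[of b]) (simp add: mult_wreath v del: mult_integer_mod_group inv_integer_mod_group)
    moreover have "(if s' then \<delta> j (v b) else inv\<^bsub>?Z\<^esub> \<delta> j (inv\<^bsub>T\<^esub> f j \<otimes>\<^bsub>T\<^esub> v b)) =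
        (if y = x then u (v b) else if y = inv_letter x then inv\<^bsub>?Z\<^esub> u (v (y # b)) else 0)"
      using v fT u W.Z.inv_one
      by (auto simp: v_Cons x y inv_letter_def \<delta>_def W.T.inv_mult_cancel simp del: mult_integer_mod_group inv_integer_mod_group)
    ultimately show ?thesis by simp
  qed
  \<comment> \<open>Here \<open>a\<close> may be empty: \<open>w\<close> itself is a proper suffix
    of \<open>x # w\<close>.\<close>
  have suf0: "g b = 0" if "w = a @ b" for a b
    using that
  proof (induction b arbitrary: a)
    case Nil
    show ?case by (simp add: g_def word_value_def one_wreath)
  next
    case (Cons y b)
    have "g b = 0" using Cons.IH[of "a @ [y]"] Cons.prems by simp
    moreover have "u (v b) = 0" using suf[rule_format, of "a @ [y]" b] Cons.prems by (simp add: v_def)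
    moreover have "u (v (y # b)) = 0" if "y = inv_letter x"
    proof -
      \<comment> \<open>With \<open>a\<close> empty, \<open>w\<close> would start with the inverse
        of \<open>x\<close>, contradicting reducedness of \<open>x # w\<close>.\<close>
      have "a \<noteq> []" using Cons.prems that \<open>reduced (x # w)\<close> by auto
      then show ?thesis using suf[rule_format, of a "y # b"] Cons.prems by (simp add: v_def)
    qed
    ultimately show ?case by (simp add: step)
  qed
  have "g (x # w) = 1 \<otimes>\<^bsub>?Z\<^esub> g w" using uw by (simp add: step v_def)
  then have gw: "g (x # w) = 1" using suf0[of "[]" w] p0 by simp
  have finW: "finite (carrier ?W)"
    using finT p0 by (auto simp: carrier_wreath carrier_integer_mod_group intro!: finite_PiE)
  obtain T' :: "nat monoid" and h where T': "group T'" "h \<in> iso ?W T'"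
    using nat_group_iso[OF W.group_wreath finW] .
  have h: "h \<in> hom ?W T'" "inj_on h (carrier ?W)" "h ` carrier ?W = carrier T'"
    using T'(2) by (auto simp: iso_iff)
  define f'' where "f'' = h \<circ> f'"
  define u' where "u' z = fst (inv_into (carrier ?W) h z) \<one>\<^bsub>T\<^esub>" for z
  have "u' z \<in> carrier ?Z" if "z \<in> carrier T'" for z
  proof -
    have "inv_into (carrier ?W) h z \<in> carrier ?W" using that h(3) by (metis inv_into_into)
    then show ?thesis unfolding u'_def carrier_wreath by auto
  qed
  moreover have u'g: "u' (word_value T' f'' b) = g b" for b
    using hom_word_value[OF W.group_wreath T'(1) h(1) f', of b] inv_into_f_f[OF h(2) W.W.word_value_closed[OF f', of b]]
    by (simp add: u'_def g_def f''_def)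
  moreover have "order T' = p ^ (order T + n)"
    using iso_order[OF T'(2)] W.order_wreath[OF finT] T(2) p0
    by (simp add: order_def carrier_integer_mod_group power_add)
  moreover have "range f'' \<subseteq> carrier T'" using f' h(3) by (auto simp: f''_def)
  moreover have "u' (word_value T' f'' b) = 0" if "x # w = a @ b" "a \<noteq> []" for a b
    using that suf0[of "tl a" b] unfolding u'g by (cases a) auto
  ultimately show ?case using T'(1) gw by (intro exI[of _ T'] exI[of _ "order T + n"] exI[of _ f''] exI[of _ u']) auto
qed

text \<open>The separating function is 1 at the value of \<open>v\<close>, but 0 at the identity,
  which is the value of the empty proper suffix.\<close>

lemma p_group_nontrivial_verbal_subgroup:
  assumes "Factorial_Ring.prime p" "V \<subseteq> carrier F_inf" "v \<in> V" "v \<noteq> \<one>\<^bsub>F_inf\<^esub>"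
  shows "\<exists>(L :: nat monoid) n l. group L \<and> order L = p ^ n \<and> l \<in> verbal_subgroup V L \<and> l \<noteq> \<one>\<^bsub>L\<^esub>"
proof -
  have v: "reduced v" "v \<noteq> []" using assms by (auto simp: free_group_def)
  obtain L :: "nat monoid" and n f and u :: "nat \<Rightarrow> int" where L: "group L" "order L = p ^ n" "range f \<subseteq> carrier L"
    "u (word_value L f v) = 1" and suf: "\<forall>a b. v = a @ b \<and> a \<noteq> [] \<longrightarrow> u (word_value L f b) = 0"
    using reduced_word_separated[OF assms(1) v(1)] by (elim exE conjE) (rule that)
  have "u \<one>\<^bsub>L\<^esub> = 0" using suf[rule_format, of v "[]"] v(2) by (simp add: word_value_def)
  then have "word_value L f v \<noteq> \<one>\<^bsub>L\<^esub>" using L(4) by auto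
  then show ?thesis using L word_value_in_verbal_subgroup[OF L(1,3) assms(3)] by blast
qed

section \<open>Embedding into verbal subgroups\<close>

text \<open>Restricting the primes by the order of \<open>H\<close> serves all sets of primes at
  once: if \<open>H\<close> is a \<open>P\<close>-group, then so is \<open>G\<close>.\<close>

definition verbal_embedding ::
    "nat letter list set \<Rightarrow> ('a, 'c) monoid_scheme \<Rightarrow> ('b, 'd) monoid_scheme \<Rightarrow> ('a \<Rightarrow> 'b) \<Rightarrow> bool" where
  "verbal_embedding V H G e \<longleftrightarrow> nilpotent_group G \<and> finite (carrier G) \<and>
     (\<forall>q. Factorial_Ring.prime q \<and> q dvd order G \<longrightarrow> q dvd order H) \<and>
     e \<in> hom H G \<and> inj_on e (carrier H) \<and> e ` carrier H \<subseteq> verbal_subgroup V G"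

lemma verbal_embeddingD:
  assumes "verbal_embedding V H G e"
  shows "nilpotent_group G" "group G" "finite (carrier G)"
    "Factorial_Ring.prime q \<Longrightarrow> q dvd order G \<Longrightarrow> q dvd order H"
    "e \<in> hom H G" "inj_on e (carrier H)"
    "e ` carrier H \<subseteq> verbal_subgroup V G" "h \<in> carrier H \<Longrightarrow> e h \<in> verbal_subgroup V G"
  using assms unfolding verbal_embedding_def nilpotent_group_def by blast+

lemma verbal_embedding_iso:
  assumes "verbal_embedding V H G e" "V \<subseteq> carrier F_inf" "group G'" "g \<in> iso G G'"
  shows "verbal_embedding V H G' (g \<circ> e)"
proof -
  note D = verbal_embeddingD[OF assms(1)]
  have g: "g \<in> hom G G'" "inj_on g (carrier G)" using assms(4) by (auto simp: iso_iff)
  have "inj_on g (e ` carrier H)" using D(5) by (intro inj_on_subset[OF g(2)]) (auto simp: hom_def)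
  moreover have "g (e h) \<in> verbal_subgroup V G'" if "h \<in> carrier H" for h
    using hom_verbal_subgroup[OF D(2) assms(3) g(1) assms(2) D(8)[OF that]] .
  ultimately show ?thesis
    using D(3,4) nilpotent_iso[OF D(1) assms(3,4)] iso_finite_iff[OF assms(4)] iso_order[OF assms(4)]
      Group.hom_compose[OF D(5) g(1)] comp_inj_on[OF D(6)]
    by (auto simp: verbal_embedding_def)
qed

lemma nat_verbal_embedding:
  assumes "verbal_embedding V H G e" "V \<subseteq> carrier F_inf"
  shows "\<exists>(G' :: nat monoid) e'. verbal_embedding V H G' e'"
proof -
  obtain G' :: "nat monoid" and g where "group G'" "g \<in> iso G G'"
    by (rule nat_group_iso[OF verbal_embeddingD(2,3)[OF assms(1)]])
  then show ?thesis using verbal_embedding_iso[OF assms] by blast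
qed

text \<open>As the kernels meet trivially, \<open>H\<close> embeds into the product of
  \<open>Q1\<close> and \<open>Q2\<close>. The verbal subgroup of a product contains those of both
  factors.\<close>

lemma verbal_embedding_DirProd:
  assumes H: "group H" and V: "V \<subseteq> carrier F_inf"
    and f1: "f1 \<in> hom H Q1" and f2: "f2 \<in> hom H Q2"
    and ker: "kernel H Q1 f1 \<inter> kernel H Q2 f2 = {\<one>\<^bsub>H\<^esub>}"
    and dvd: "order Q1 dvd order H" "order Q2 dvd order H"
    and Q1: "group Q1" and Q2: "group Q2"
    and e1: "verbal_embedding V Q1 G1 e1" and e2: "verbal_embedding V Q2 G2 e2"
  shows "verbal_embedding V H (G1 \<times>\<times> G2) (\<lambda>h. (e1 (f1 h), e2 (f2 h)))"
proof -
  note e1D = verbal_embeddingD[OF e1] and e2D = verbal_embeddingD[OF e2]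
  have G: "group G1" "group G2" using e1D(2) e2D(2) .
  have G12: "group (G1 \<times>\<times> G2)" using DirProd_group[OF G] .
  interpret e1: group_hom Q1 G1 e1 by (rule group_homI[OF Q1 G(1) e1D(5)])
  interpret e2: group_hom Q2 G2 e2 by (rule group_homI[OF Q2 G(2) e2D(5)])
  interpret f1: group_hom H Q1 f1 by (rule group_homI[OF H Q1 f1])
  interpret f2: group_hom H Q2 f2 by (rule group_homI[OF H Q2 f2])
  let ?e = "\<lambda>h. (e1 (f1 h), e2 (f2 h))"
  have e: "?e \<in> hom H (G1 \<times>\<times> G2)" by (auto simp: hom_def)
  then interpret e: group_hom H "G1 \<times>\<times> G2" ?e by (rule group_homI[OF H G12])
  have "inj_on ?e (carrier H)"
  proof (unfold e.inj_on_one_iff, intro allI impI)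
    fix h assume h: "h \<in> carrier H" and "?e h = \<one>\<^bsub>G1 \<times>\<times> G2\<^esub>"
    then have "e1 (f1 h) = e1 \<one>\<^bsub>Q1\<^esub>" "e2 (f2 h) = e2 \<one>\<^bsub>Q2\<^esub>" by auto
    then have "f1 h = \<one>\<^bsub>Q1\<^esub>" "f2 h = \<one>\<^bsub>Q2\<^esub>"
      using inj_onD[OF e1D(6)] inj_onD[OF e2D(6)] h by auto
    then show "h = \<one>\<^bsub>H\<^esub>" using ker h by (auto simp: kernel_def)
  qed
  moreover have "?e h \<in> verbal_subgroup V (G1 \<times>\<times> G2)" if h: "h \<in> carrier H" for h
  proof -
    have "e1 (f1 h) \<in> verbal_subgroup V G1" "e2 (f2 h) \<in> verbal_subgroup V G2"
      using e1D(8) e2D(8) h by auto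
    then have "(e1 (f1 h), \<one>\<^bsub>G2\<^esub>) \<in> verbal_subgroup V (G1 \<times>\<times> G2)"
      "(\<one>\<^bsub>G1\<^esub>, e2 (f2 h)) \<in> verbal_subgroup V (G1 \<times>\<times> G2)"
      using hom_verbal_subgroup[OF G(1) G12 _ V, of "\<lambda>x. (x, \<one>\<^bsub>G2\<^esub>)"]
        hom_verbal_subgroup[OF G(2) G12 _ V, of "\<lambda>x. (\<one>\<^bsub>G1\<^esub>, x)"]
      by (auto simp: hom_def)
    from subgroup.m_closed[OF verbal_subgroup_subgroup[OF G12 V] this] show ?thesis using h by simp
  qed
  moreover have "q dvd order H" if "Factorial_Ring.prime q" "q dvd order (G1 \<times>\<times> G2)" for q
  proof -
    have "q dvd order G1 * order G2" using that(2) by (simp add: order_def card_cartesian_product)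
    then have "q dvd order Q1 \<or> q dvd order Q2"
      using that(1) e1D(4) e2D(4) prime_dvd_mult_iff by blast
    then show ?thesis using dvd dvd_trans by blast
  qed
  moreover have "nilpotent_group (G1 \<times>\<times> G2)" "finite (carrier (G1 \<times>\<times> G2))"
    using e1D(3) e2D(3) nilpotent_DirProd[OF e1D(1) e2D(1)] by simp_all
  ultimately show ?thesis unfolding verbal_embedding_def using e by blast
qed

text \<open>Since \<open>K\<close> brings no new primes, \<open>N\<close>, \<open>K\<close> and
  \<open>L\<close> all have \<open>p\<close>-power order. So does the wreath product, and this is
  the source of its nilpotency.\<close>

lemma p_group_central_extension_verbal_embedding:
  assumes H: "group H" "order H = p ^ n" and p: "Factorial_Ring.prime p" "p dvd order H"
    and V: "V \<subseteq> carrier F_inf" "v \<in> V" "v \<noteq> \<one>\<^bsub>F_inf\<^esub>"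
    and Q: "group Q" "order Q dvd order H"
    and f: "f \<in> hom H Q" "kernel H Q f = N" "N \<subseteq> centre H"
    and e: "verbal_embedding V Q (K :: ('b, 'd) monoid_scheme) e"
  shows "\<exists>(G :: nat monoid) e'. verbal_embedding V H G e'"
proof -
  note eD = verbal_embeddingD[OF e]
  have K: "group K" "finite (carrier K)" by (rule eD)+
  interpret H: group H by fact
  interpret K: group K by fact
  interpret f: group_hom H Q f by (rule group_homI[OF H(1) Q(1) f(1)])
  interpret e: group_hom Q K e by (rule group_homI[OF Q(1) K(1) eD(5)])
  have unique: "q = p" if "Factorial_Ring.prime q" "q dvd order H" for q
    using that p(1) H(2) by (metis prime_dvd_power primes_dvd_imp_eq)
  have "order K > 0" using K.order_gt_0_iff_finite K(2) by blast
  moreover have "q = p" if "Factorial_Ring.prime q" "q dvd order K" for q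
    using unique[OF that(1) dvd_trans[OF eD(4)[OF that] Q(2)]] .
  ultimately obtain k where k: "order K = p ^ k" using prime_power_of_unique_prime by blast
  obtain L :: "nat monoid" and m l where L: "group L" "order L = p ^ m"
    "l \<in> verbal_subgroup V L" "l \<noteq> \<one>\<^bsub>L\<^esub>"
    using p_group_nontrivial_verbal_subgroup[OF p(1) V] by (elim exE conjE) (rule that)
  have sub: "subgroup N H" using f.subgroup_kernel f(2) by simp
  then have "card N dvd p ^ n" using H.lagrange[OF sub] H(2) by (metis dvd_triv_right)
  then obtain a where a: "card N = p ^ a" using divides_primepow_nat[OF p(1)] by blast
  let ?Z = "H\<lparr>carrier := N\<rparr>"
  let ?W = "wreath ?Z (K \<times>\<times> L)"
  interpret W: wreath_product ?Z "K \<times>\<times> L"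
    using H.subgroup_imp_group[OF sub] DirProd_group[OF K(1) L(1)] by (simp add: wreath_product_def)
  have "e (f h) = \<one>\<^bsub>K\<^esub> \<longleftrightarrow> f h = \<one>\<^bsub>Q\<^esub>" if "h \<in> carrier H" for h
    using that eD(6) e.inj_on_one_iff by auto
  then have ker: "kernel H K (e \<circ> f) = N" using f(2) by (auto simp: kernel_def)
  have "(e \<circ> f) ` carrier H \<subseteq> verbal_subgroup V K" using eD(8) by auto
  from wreath_embedding_into_verbal_subgroup[OF H(1) K(1) L(1) V(1)
      Group.hom_compose[OF f(1) e.homh] ker f(3) this L(3,4)]
  obtain e' where e': "e' \<in> hom H ?W" "inj_on e' (carrier H)"
    "e' ` carrier H \<subseteq> verbal_subgroup V ?W" by (elim bexE conjE) (rule that)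
  have "finite (carrier (K \<times>\<times> L))"
    using K(2) L(2) p(1) monoid.order_gt_0_iff_finite[OF group.is_monoid[OF L(1)]] by (simp add: prime_gt_0_nat)
  from W.order_wreath[OF this] have ord: "order ?W = p ^ (a * order (K \<times>\<times> L) + (k + m))"
    using a k L(2) by (simp add: order_def card_cartesian_product power_add power_mult)
  then have "finite (carrier ?W)"
    using p(1) W.W.order_gt_0_iff_finite by (simp add: prime_gt_0_nat)
  then obtain G :: "nat monoid" and g where G: "group G" "g \<in> iso ?W G"
    using nat_group_iso[OF W.group_wreath] by blast
  have "nilpotent_group G"
    using p_group_nilpotent[OF G(1) p(1)] iso_order[OF G(2)] ord by simp
  \<comment> \<open>Nilpotency was obtained for the copy on \<open>nat\<close>; the inverse
    isomorphism carries it back to the wreath product.\<close>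
  moreover have "inv_into (carrier ?W) g \<in> iso G ?W" using W.W.iso_set_sym[OF G(2)] .
  ultimately have "nilpotent_group ?W" using nilpotent_iso W.group_wreath by blast
  moreover have "q dvd order H" if "Factorial_Ring.prime q" "q dvd order ?W" for q
    using that p ord by (metis prime_dvd_power primes_dvd_imp_eq)
  ultimately have "verbal_embedding V H ?W e'"
    using e' \<open>finite (carrier ?W)\<close> unfolding verbal_embedding_def by blast
  then show ?thesis using nat_verbal_embedding V(1) by blast
qed

text \<open>Central elements of distinct prime orders would generate nontrivial normal subgroups of
  coprime orders, which meet trivially by Lagrange.\<close>

lemma nilpotent_prime_power_order:
  fixes H :: "nat monoid"
  assumes H: "nilpotent_group H" "finite (carrier H)" and p: "Factorial_Ring.prime p" "p dvd order H"
    and meet: "\<And>N1 N2. N1 \<lhd> H \<Longrightarrow> N2 \<lhd> H \<Longrightarrow> N1 \<inter> N2 = {\<one>\<^bsub>H\<^esub>} \<Longrightarrow> N1 = {\<one>\<^bsub>H\<^esub>} \<or> N2 = {\<one>\<^bsub>H\<^esub>}"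
  shows "\<exists>n. order H = p ^ n"
proof (rule prime_power_of_unique_prime)
  interpret group H using H(1) by (simp add: nilpotent_group_def)
  show "order H > 0" using order_gt_0_iff_finite H(2) by blast
  fix q assume q: "Factorial_Ring.prime q" "q dvd order H"
  obtain c where c: "c \<in> centre H" "ord c = p" using nilpotent_central_prime_order[OF H p] by blast
  obtain d where d: "d \<in> centre H" "ord d = q" using nilpotent_central_prime_order[OF H q] by blast
  have cd: "c \<in> carrier H" "d \<in> carrier H" using centreD(1)[OF c(1)] centreD(1)[OF d(1)] by simp_all
  let ?A = "\<lambda>x. generate H {x}"
  have sub: "subgroup (?A x) H" if "x \<in> carrier H" for x
    using that by (intro generate_is_subgroup) simp
  have normal: "?A x \<lhd> H" if "x \<in> centre H" for x
  proof (rule central_subgroup_normal[OF sub])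
    show "x \<in> carrier H" using that by (rule centreD(1))
    show "?A x \<subseteq> centre H" using that by (intro generate_subgroup_incl subgroup_centre) simp
  qed
  have card: "card (?A x) = ord x" if "x \<in> carrier H" for x using generate_pow_card[OF that] ..
  have ne: "?A x \<noteq> {\<one>\<^bsub>H\<^esub>}" if "x \<in> carrier H" "Factorial_Ring.prime (ord x)" for x
    using card[OF that(1)] prime_gt_1_nat[OF that(2)] by auto
  show "q = p"
  proof (rule ccontr)
    assume "q \<noteq> p"
    then have cop: "coprime p q" using p q by (simp add: primes_coprime)
    have "x = \<one>\<^bsub>H\<^esub>" if x: "x \<in> ?A c" "x \<in> ?A d" for x
    proof -
      have "ord x dvd p" "ord x dvd q"
        using ord_dvd_subgroup_card[OF sub x(1)] ord_dvd_subgroup_card[OF sub x(2)] card cd c d by auto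
      then have "ord x = 1" using cop by (metis coprime_common_divisor nat_dvd_1_iff_1)
      moreover have "x \<in> carrier H" using subgroup.mem_carrier[OF sub x(1)] cd by simp
      ultimately show ?thesis using ord_eq_1 by blast
    qed
    then have "?A c \<inter> ?A d = {\<one>\<^bsub>H\<^esub>}" by (auto intro: generate.one)
    then show False
      using meet[OF normal[OF c(1)] normal[OF d(1)]] ne[OF cd(1)] ne[OF cd(2)] c(2) d(2) p(1) q(1) by auto
  qed
qed

lemma quotient_order_less:
  fixes H :: "('a, 'b) monoid_scheme"
  assumes "group H" "finite (carrier H)" "subgroup N H" "N \<noteq> {\<one>\<^bsub>H\<^esub>}" "m * card N = order H"
  shows "m < order H"
proof -
  have "\<one>\<^bsub>H\<^esub> \<in> N" "finite N"
    using subgroup.one_closed[OF assms(3)] subgroup.subset[OF assms(3)] assms(2) finite_subset by auto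
  then have "card N \<noteq> 0" "card N \<noteq> 1" using assms(4) by (auto simp: card_1_singleton_iff)
  moreover have "m > 0" using assms(5) monoid.order_gt_0_iff_finite[OF group.is_monoid[OF assms(1)]] assms(2) by (cases m) auto
  ultimately show ?thesis using n_less_n_mult_m[of m "card N"] assms(5) by simp
qed

lemma nilpotent_verbal_embedding:
  fixes H :: "nat monoid"
  assumes "nilpotent_group H" "finite (carrier H)"
    and V: "V \<subseteq> carrier F_inf" "v \<in> V" "v \<noteq> \<one>\<^bsub>F_inf\<^esub>"
  shows "\<exists>(G :: nat monoid) e. verbal_embedding V H G e"
  using assms(1,2)
proof (induction "order H" arbitrary: H rule: less_induct)
  case less
  have H: "group H" using less.prems by (simp add: nilpotent_group_def)
  interpret H: group H by fact
  \<comment> \<open>The induction hypothesis, packaged for quotients by nontrivial normal subgroups;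
    both cases below use it.\<close>
  have quotient: "\<exists>(Q :: nat monoid) f (G :: nat monoid) e. group Q \<and> f \<in> hom H Q \<and>
      kernel H Q f = N \<and> order Q dvd order H \<and> verbal_embedding V Q G e"
    if N: "N \<lhd> H" "N \<noteq> {\<one>\<^bsub>H\<^esub>}" for N
  proof -
    obtain Q :: "nat monoid" and f where Q: "group Q" "f \<in> hom H Q" "f ` carrier H = carrier Q"
      "kernel H Q f = N" "order Q * card N = order H" "finite (carrier Q)"
      by (rule quotient_nat_group[OF N(1) less.prems(2)])
    have "order Q < order H"
      using quotient_order_less[OF H less.prems(2) normal_imp_subgroup[OF N(1)] N(2) Q(5)] .
    moreover have "nilpotent_group Q" using nilpotent_surj[OF less.prems(1) Q(1-3)] .
    ultimately obtain G :: "nat monoid" and e where "verbal_embedding V Q G e"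
      using less.hyps Q(6) by blast
    moreover have "order Q dvd order H" using Q(5) by (metis dvd_triv_left)
    ultimately show ?thesis using Q by blast
  qed
  show ?case
  proof (cases "order H = 1")
    case True
    then obtain z where "carrier H = {z}" by (auto simp: order_def card_1_singleton_iff)
    then have "carrier H = {\<one>\<^bsub>H\<^esub>}" using H.one_closed by auto
    moreover have "\<one>\<^bsub>H\<^esub> \<in> verbal_subgroup V H"
      using subgroup.one_closed[OF verbal_subgroup_subgroup[OF H V(1)]] .
    moreover have "id \<in> hom H H" by (auto simp: hom_def)
    \<comment> \<open>A trivial group equals its own verbal subgroup, so it embeds by the identity
      map.\<close>
    ultimately have "verbal_embedding V H H id"
      using less.prems by (simp add: verbal_embedding_def)
    then show ?thesis by blast
  next
    case False
    show ?thesis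
    proof (cases "\<exists>N1 N2. N1 \<lhd> H \<and> N2 \<lhd> H \<and> N1 \<inter> N2 = {\<one>\<^bsub>H\<^esub>} \<and> N1 \<noteq> {\<one>\<^bsub>H\<^esub>} \<and> N2 \<noteq> {\<one>\<^bsub>H\<^esub>}")
      case True
      then obtain N1 N2 where N: "N1 \<lhd> H" "N2 \<lhd> H" "N1 \<inter> N2 = {\<one>\<^bsub>H\<^esub>}" "N1 \<noteq> {\<one>\<^bsub>H\<^esub>}" "N2 \<noteq> {\<one>\<^bsub>H\<^esub>}"
        by blast
      obtain Q1 :: "nat monoid" and f1 and G1 :: "nat monoid" and e1 where 1: "group Q1" "f1 \<in> hom H Q1"
        "kernel H Q1 f1 = N1" "order Q1 dvd order H" "verbal_embedding V Q1 G1 e1"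
        using quotient[OF N(1,4)] by (elim exE conjE) (rule that)
      obtain Q2 :: "nat monoid" and f2 and G2 :: "nat monoid" and e2 where 2: "group Q2" "f2 \<in> hom H Q2"
        "kernel H Q2 f2 = N2" "order Q2 dvd order H" "verbal_embedding V Q2 G2 e2"
        using quotient[OF N(2,5)] by (elim exE conjE) (rule that)
      have "kernel H Q1 f1 \<inter> kernel H Q2 f2 = {\<one>\<^bsub>H\<^esub>}" using 1(3) 2(3) N(3) by simp
      then show ?thesis
        using verbal_embedding_DirProd[OF H V(1) 1(2) 2(2) _ 1(4) 2(4) 1(1) 2(1) 1(5) 2(5)]
          nat_verbal_embedding[OF _ V(1)] by blast
    next
      case no_pair: False
      obtain p where p: "Factorial_Ring.prime p" "p dvd order H" using False prime_factor_nat by blast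
      obtain n where n: "order H = p ^ n"
        using nilpotent_prime_power_order[OF less.prems p] no_pair by blast
      have "carrier H \<noteq> {\<one>\<^bsub>H\<^esub>}" using False by (auto simp: order_def)
      then have Z: "centre H \<noteq> {\<one>\<^bsub>H\<^esub>}" "centre H \<lhd> H"
        using nilpotent_centre[OF less.prems(1)] H.central_subgroup_normal[OF H.subgroup_centre] by auto
      obtain Q :: "nat monoid" and f and K :: "nat monoid" and e where Q: "group Q" "f \<in> hom H Q"
        "kernel H Q f = centre H" "order Q dvd order H" "verbal_embedding V Q K e"
        using quotient[OF Z(2,1)] by (elim exE conjE) (rule that)
      show ?thesis
        by (rule p_group_central_extension_verbal_embedding[OF H n p V Q(1,4,2,3) subset_refl Q(5)])
    qed
  qed
qed

theorem proposition1:
  fixes H :: "'a monoid" and V :: "nat letter list set"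
  assumes "nilpotent_group H" and "finite (carrier H)"
    and "V \<subseteq> carrier F_inf" and "\<exists>v\<in>V. v \<noteq> \<one>\<^bsub>F_inf\<^esub>"
  shows "(\<exists>(G :: nat monoid) H'.
            nilpotent_group G \<and> finite (carrier G) \<and>
            subnormal H' G \<and> G\<lparr>carrier := H'\<rparr> \<cong> H \<and> H' \<subseteq> verbal_subgroup V G) \<and>
         (\<forall>P :: nat set. (\<forall>p\<in>P. Factorial_Ring.prime p) \<and> pi_group P H \<longrightarrow>
           (\<exists>(G :: nat monoid) H'.
              nilpotent_group G \<and> finite (carrier G) \<and> pi_group P G \<and>
              subnormal H' G \<and> G\<lparr>carrier := H'\<rparr> \<cong> H \<and> H' \<subseteq> verbal_subgroup V G))"
proof -
  have H: "group H" using assms(1) by (simp add: nilpotent_group_def)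
  obtain v where v: "v \<in> V" "v \<noteq> \<one>\<^bsub>F_inf\<^esub>" using assms(4) by blast
  obtain H0 :: "nat monoid" and g where H0: "group H0" "g \<in> iso H H0"
    using nat_group_iso[OF H assms(2)] .
  obtain G :: "nat monoid" and e where e: "verbal_embedding V H0 G e"
    using nilpotent_verbal_embedding[OF nilpotent_iso[OF assms(1) H0] _ assms(3) v]
      iso_finite_iff[OF H0(2)] assms(2) by blast
  note eD = verbal_embeddingD[OF e]
  have G: "nilpotent_group G" "group G" "finite (carrier G)" by (rule eD)+
  define H' where "H' = e ` carrier H0"
  have eh: "e \<in> hom H0 G" "inj_on e (carrier H0)" "H' \<subseteq> verbal_subgroup V G"
    unfolding H'_def by (rule eD)+
  interpret e: group_hom H0 G e by (rule group_homI[OF H0(1) G(2) eh(1)])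
  have sub: "subgroup H' G" unfolding H'_def by (rule e.img_is_subgroup)
  have "e \<in> iso H0 (G\<lparr>carrier := H'\<rparr>)"
    using eh(1,2) by (auto simp: iso_def hom_def bij_betw_def H'_def)
  then have "H0 \<cong> G\<lparr>carrier := H'\<rparr>" by (rule is_isoI)
  then have "H \<cong> G\<lparr>carrier := H'\<rparr>" using is_isoI[OF H0(2)] iso_trans by blast
  then have iso: "G\<lparr>carrier := H'\<rparr> \<cong> H" by (rule group.iso_sym[OF H])
  \<comment> \<open>The group \<open>G\<close> was fixed before any \<open>P\<close>; as it brings
    no new primes, it also serves the second claim.\<close>
  have "q dvd order H" if "Factorial_Ring.prime q" "q dvd order G" for q
    using eD(4)[OF that] iso_order[OF H0(2)] by simp
  then have "pi_group P G" if "pi_group P H" for P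
    using that G(2,3) by (auto simp: pi_group_def)
  then show ?thesis
    using G(1,3) nilpotent_subgroup_subnormal[OF G(1) sub] iso eh(3) by blast
qed

end
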